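(* Let $P:\mathbb R_+\times\mathbb T\to\mathbb R$ be a function whose Fourier transform is of the form $\widehat P_t(k)=\phi(t^\beta|k|^\alpha)$, where $\alpha>1$, $\beta>\frac12$ and $\phi$ satisfies the assumption stated in the context with some $\ell_\star\in\mathbb N$. Let $\gamma\in[0,\infty)$ and $f\in\mathcal C^\gamma(\mathbb T)$. Then for any $m\in\mathbb N_0$ satisfying $m<\gamma+\alpha\ell_\star$, any $\widetilde\gamma\in(0,\infty)\setminus\mathbb N$ satisfying $0\le\widetilde\gamma-\gamma+m<\alpha\ell_\star$ and any $\kappa\in(0,\gamma-\widetilde\gamma+\alpha\ell_\star-m]$ one has $$\big\|\partial_x^m(P_t*f)\big\|_{\mathcal C^{\widetilde\gamma}}\le C\,t^{-\frac\beta\alpha(\widetilde\gamma-\gamma+m+\kappa)}\|f\|_{\mathcal C^\gamma}$$ uniformly over $t>0$, where $C=C(\kappa,m)>0$. Furthermore, for any $\varepsilon\in[0,\beta]$ one has $$\big\|\partial_x^m(P_{t'}-P_t)*f\big\|_{\mathcal C^{\widetilde\gamma}}\le C\,(t'-t)^\varepsilon\,t^{-\frac\beta\alpha(\widetilde\gamma-\gamma+m+\kappa)-\varepsilon}\|f\|_{\mathcal C^\gamma}$$ uniformly over $0<t<t'$.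
   Context: $\mathbb T=\mathbb R/2\pi\mathbb Z$, identified with $[-\pi,\pi]$; $\mathbb R_+=[0,\infty)$; $\mathbb N=\{1,2,\ldots\}$; $\mathbb N_0=\mathbb N\cup\{0\}$; $P_t=P(t,\cdot)$; $*$ is convolution on $\mathbb T$ in the spatial variable; $\widehat P_t(k)=\frac1{\sqrt{2\pi}}\int_{-\pi}^\pi P(t,x)e^{-ikx}\,dx$ for $k\in\mathbb Z$. The derivative $\partial_x^m$ is understood in the sense of distributions. For $\gamma\ge0$, $\mathcal C^\gamma(\mathbb T)$ is the space of functions with continuous derivatives up to order $\lfloor\gamma\rfloor$ whose derivative of order $\lfloor\gamma\rfloor$ is $(\gamma-\lfloor\gamma\rfloor)$-Hölder continuous (no Hölder condition for $\gamma\in\mathbb N_0$), with its usual norm $\|\cdot\|_{\mathcal C^\gamma}$. Assumption on $\phi$: the function $\phi:\mathbb R_+\to\mathbb R$ is positive, strictly decreasing, and satisfies $\big|\frac{d^j}{dx^j}\phi(x)\big|\le\frac{C}{1+x^{\ell_\star+j}}$ for all $x\in\mathbb R_+$ and $j\in\mathbb N_0$, and for some $\ell_\star\in\mathbb N$ (here $C$ denotes a constant); moreover, $-\phi'(x)$ is positive and decreasing on $x\ge0$.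
   Formalization: For m=0 and f of nonzero mean the first estimate is claimed only for 0<t≤T, with C depending on T (it fails as t→∞, e.g. f=1); the second is claimed for ε∈[0,min(β,1)] instead of [0,β] (it fails for ε>1 as t'→t, e.g. f=cos). *)

theory Defs
  imports "HOL-Analysis.Analysis"
begin

text \<open>
  Functions on the torus \<open>\<real>/2\<pi>\<int>\<close> are represented by \<open>2\<pi>\<close>-periodic functions on \<open>\<real>\<close>.
\<close>

definition periodic_2pi :: "(real \<Rightarrow> real) \<Rightarrow> bool" where
  "periodic_2pi u \<longleftrightarrow> (\<forall>x. u (x + 2 * pi) = u x)"

definition L1_torus :: "(real \<Rightarrow> real) set" where
  "L1_torus = {u. periodic_2pi u \<and> u absolutely_integrable_on {-pi..pi}}"

definition fourier_torus :: "(real \<Rightarrow> real) \<Rightarrow> int \<Rightarrow> complex" where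
  "fourier_torus u k =
     complex_of_real (1 / sqrt (2 * pi)) *
     integral {-pi..pi} (\<lambda>x. complex_of_real (u x) * exp (- (\<i> * of_int k * of_real x)))"

definition conv_torus :: "(real \<Rightarrow> real) \<Rightarrow> (real \<Rightarrow> real) \<Rightarrow> real \<Rightarrow> real" where
  "conv_torus p f x = integral {-pi..pi} (\<lambda>y. p (x - y) * f y)"

definition Cn_torus :: "nat \<Rightarrow> (real \<Rightarrow> real) set" where
  "Cn_torus n = {f. periodic_2pi f \<and>
     (\<forall>i<n. \<forall>x. (deriv ^^ i) f differentiable (at x)) \<and>
     (\<forall>i\<le>n. continuous_on UNIV ((deriv ^^ i) f))}"

text \<open>
  For periodic \<open>g\<close> and \<open>s > 0\<close> it makes no difference whether the Hoelder quotient is formed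
  with \<open>\<bar>x - y\<bar>\<close> or with the distance of \<open>x\<close> and \<open>y\<close> on the torus: the latter is the minimum
  of the former over all representatives of \<open>y\<close>.
\<close>

definition holder_continuous :: "real \<Rightarrow> (real \<Rightarrow> real) \<Rightarrow> bool" where
  "holder_continuous s g \<longleftrightarrow> (\<exists>L. \<forall>x y. \<bar>g x - g y\<bar> \<le> L * \<bar>x - y\<bar> powr s)"

definition holder_seminorm :: "real \<Rightarrow> (real \<Rightarrow> real) \<Rightarrow> real" where
  "holder_seminorm s g = (SUP (x, y) \<in> {(x, y). x \<noteq> y}. \<bar>g x - g y\<bar> / \<bar>x - y\<bar> powr s)"

definition holder_space :: "real \<Rightarrow> (real \<Rightarrow> real) set" where
  "holder_space \<gamma> = {f. f \<in> Cn_torus (nat \<lfloor>\<gamma>\<rfloor>) \<and>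
     (\<gamma> \<notin> \<nat> \<longrightarrow> holder_continuous (frac \<gamma>) ((deriv ^^ nat \<lfloor>\<gamma>\<rfloor>) f))}"

text \<open>Meaningful only for \<open>f \<in> holder_space \<gamma>\<close>, where all the suprema are finite.\<close>

definition holder_norm :: "real \<Rightarrow> (real \<Rightarrow> real) \<Rightarrow> real" where
  "holder_norm \<gamma> f =
     (\<Sum>i\<le>nat \<lfloor>\<gamma>\<rfloor>. SUP x. \<bar>(deriv ^^ i) f x\<bar>) +
     (if \<gamma> \<in> \<nat> then 0 else holder_seminorm (frac \<gamma>) ((deriv ^^ nat \<lfloor>\<gamma>\<rfloor>) f))"

text \<open>Distributions on the torus are functionals; only their values on \<open>test_torus\<close> matter.\<close>

definition test_torus :: "(real \<Rightarrow> real) set" where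
  "test_torus = (\<Inter>n. Cn_torus n)"

definition distr_of :: "(real \<Rightarrow> real) \<Rightarrow> (real \<Rightarrow> real) \<Rightarrow> real" where
  "distr_of u \<psi> = integral {-pi..pi} (\<lambda>x. u x * \<psi> x)"

definition distr_deriv :: "nat \<Rightarrow> ((real \<Rightarrow> real) \<Rightarrow> real) \<Rightarrow> (real \<Rightarrow> real) \<Rightarrow> real" where
  "distr_deriv m T \<psi> = (-1) ^ m * T ((deriv ^^ m) \<psi>)"

text \<open>
  The distribution \<open>T\<close> is a function of class \<open>\<C>\<^sup>\<gamma>\<close> whose norm is at most \<open>B\<close>.  That function is
  unique, since it is continuous.
\<close>

definition holder_norm_le :: "real \<Rightarrow> ((real \<Rightarrow> real) \<Rightarrow> real) \<Rightarrow> real \<Rightarrow> bool" where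
  "holder_norm_le \<gamma> T B \<longleftrightarrow>
     (\<exists>g \<in> holder_space \<gamma>. (\<forall>\<psi> \<in> test_torus. T \<psi> = distr_of g \<psi>) \<and> holder_norm \<gamma> g \<le> B)"

text \<open>
  \<open>D j\<close> is the \<open>j\<close>-th derivative of \<open>\<phi>\<close> on \<open>[0,\<infinity>)\<close>, one-sided at \<open>0\<close>; values of \<open>\<phi>\<close> on the
  negative half-line are irrelevant.  The constant in the decay bound depends on \<open>j\<close>: with a
  constant common to all \<open>j\<close> Taylor's formula would make \<open>\<phi>\<close> an entire function tending to \<open>0\<close>
  at infinity, hence \<open>\<phi> = 0\<close>.
\<close>

definition phi_assumption :: "(real \<Rightarrow> real) \<Rightarrow> nat \<Rightarrow> bool" where
  "phi_assumption \<phi> l \<longleftrightarrow>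
     (\<forall>x\<ge>0. \<phi> x > 0) \<and>
     (\<forall>x\<ge>0. \<forall>y>x. \<phi> y < \<phi> x) \<and>
     (\<exists>D :: nat \<Rightarrow> real \<Rightarrow> real.
        (\<forall>x\<ge>0. D 0 x = \<phi> x) \<and>
        (\<forall>j. \<forall>x\<ge>0. (D j has_real_derivative D (Suc j) x) (at x within {0..})) \<and>
        (\<forall>j. \<exists>C. \<forall>x\<ge>0. \<bar>D j x\<bar> \<le> C / (1 + x ^ (l + j))) \<and>
        (\<forall>x\<ge>0. - D 1 x > 0) \<and>
        (\<forall>x\<ge>0. \<forall>y\<ge>x. - D 1 y \<le> - D 1 x))"

end

theory Submission
  imports Defs
begin

text \<open>
  Put \<open>a k = \<phi> (t powr \<beta> * k powr \<alpha>)\<close>.  Two summations by parts turn \<open>P t * f\<close> into a series of Fejer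
  means of \<open>f\<close>, the \<open>k\<close>-th with weight \<open>(k + 1) (a k - 2 a (k + 1) + a (k + 2))\<close> up to a constant.  The
  decay of the derivatives of \<open>\<phi>\<close> makes this weight \<open>O(t powr (- \<beta> s / \<alpha>) k powr (- 1 - s))\<close> for every
  \<open>s\<close> in \<open>[0, \<alpha> l]\<close>, uniformly in \<open>t\<close>.  By Bernstein's inequality the \<open>m\<close>-th derivative of the \<open>k\<close>-th
  Fejer mean has Hoelder norm of order \<open>\<gamma>'\<close> at most \<open>O(k powr (\<gamma>' - \<gamma> + m))\<close>.  For
  \<open>s = \<gamma>' - \<gamma> + m + \<kappa>\<close> the \<open>k\<close>-th term is thus \<open>O(k powr (- 1 - \<kappa>))\<close>, and the sum is bounded uniformly in
  \<open>\<gamma>'\<close>, even near the integers.  For the time increments the same argument applies to the difference of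
  the two symbols, which gains the factor \<open>min 2 ((t' / t) powr \<beta> - 1)\<close>.
\<close>

subsection \<open>Integrals of periodic functions and the Fejer kernel\<close>

text \<open>Fejer means serve better than partial sums because their kernel is nonnegative:
  averaging against it costs no constant in the sup norm or in a Hoelder seminorm, whereas the
  Dirichlet kernels have unbounded L1 norms. As \<alpha> > 1, the function x -> \<phi>(t^\<beta>
  x^\<alpha>) is concave near 0 and cannot stay so, hence for small t the weights take both signs;
  only their absolute sums are used.

  The obstacle is the zero frequency. Derivatives and Hoelder seminorms do not see the mean of f,
  but for m = 0 the sup norm does: the mean of P_t * f is \<phi>(0) times the mean of f, up to a
  fixed factor, for every t, while the claimed bound tends to 0 as t grows. This forces t <= T when
  m = 0 and the mean of f is nonzero, with a constant depending on T. Time increments have no zero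
  mode and hence no such restriction. For them \<epsilon> <= 1 is forced: P_t' - P_t is of first
  order in t' - t, so no higher power can be gained as t' tends to t.\<close>

lemma has_integral_shift_real:
  fixes f :: "real \<Rightarrow> real"
  assumes "(f has_integral I) {a..b}"
  shows "((\<lambda>x. f (x + c)) has_integral I) {a - c..b - c}"
  using has_integral_affinity'[of f I a b 1 c] assms by simp

lemma periodic_2pi_shift:
  assumes "periodic_2pi u"
  shows "u (x - 2 * pi) = u x" "u (x + 2 * pi) = u x" "u (x + 2 * pi * of_int n) = u x"
proof -
  show 1: "u (x + 2 * pi) = u x" for x
    using assms by (simp add: periodic_2pi_def)
  show 2: "u (x - 2 * pi) = u x" for x
    using 1[of "x - 2 * pi"] by simp
  have 3: "u (y + 2 * pi * real k) = u y" for k y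
  proof (induction k)
    case (Suc k)
    then show ?case using 1[of "y + 2 * pi * real k"] by (simp add: algebra_simps)
  qed simp
  show "u (x + 2 * pi * of_int n) = u x"
  proof (cases "n \<ge> 0")
    case True
    then show ?thesis using 3[of x "nat n"] by simp
  next
    case False
    then show ?thesis using 3[of "x + 2 * pi * of_int n" "nat (- n)"] by simp
  qed
qed

lemma periodic_2pi_reduce:
  obtains n :: int where "x + 2 * pi * of_int n \<in> {-pi..<pi}"
proof
  define n where "n = - \<lfloor>(x + pi) / (2 * pi)\<rfloor>"
  have "of_int (-n) \<le> (x + pi) / (2 * pi)" "(x + pi) / (2 * pi) < of_int (-n) + 1"
    unfolding n_def by linarith+
  then have "of_int (-n) * (2 * pi) \<le> x + pi" "x + pi < (of_int (-n) + 1) * (2 * pi)"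
    using pi_gt_zero by (simp_all add: field_simps)
  then show "x + 2 * pi * of_int n \<in> {-pi..<pi}"
    by (simp add: algebra_simps)
qed

text \<open>Full periods bring the centre into [-pi, pi). Then [-pi, pi] is cut at the end of the
  shifted window that lies inside it, and the part outside the window is carried over by one
  period.\<close>

lemma has_integral_periodic_shift:
  assumes per: "periodic_2pi u" and u: "(u has_integral I) {-pi..pi}"
  shows "(u has_integral I) {c - pi..c + pi}"
proof -
  obtain n :: int where n: "c + 2 * pi * of_int n \<in> {-pi..<pi}"
    by (rule periodic_2pi_reduce)
  define r where "r = c + 2 * pi * of_int n"
  have *: "(u has_integral I) {r - pi..r + pi}" if "r \<ge> 0" "r < pi" for r
  proof -
    have int: "u integrable_on {-pi..pi}" using u by blast
    have i1: "u integrable_on {-pi..r - pi}" "u integrable_on {r - pi..pi}"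
      using that by (auto intro: integrable_subinterval_real[OF int])
    have "I = integral {-pi..r - pi} u + integral {r - pi..pi} u"
      using Henstock_Kurzweil_Integration.integral_combine[OF _ _ int, of "r - pi"] that u
      by (simp add: integral_unique)
    moreover have "((\<lambda>x. u (x + - (2 * pi))) has_integral integral {-pi..r - pi} u)
        {-pi - - (2 * pi)..r - pi - - (2 * pi)}"
      by (intro has_integral_shift_real integrable_integral i1)
    then have "(u has_integral integral {-pi..r - pi} u) {pi..r + pi}"
      using periodic_2pi_shift(1)[OF per] by (simp add: add.commute)
    ultimately show ?thesis
      using has_integral_combine[of "r - pi" pi "r + pi" u] integrable_integral[OF i1(2)] that
      by (simp add: add.commute)
  qed
  have **: "(u has_integral I) {r - pi..r + pi}"
  proof (cases "r \<ge> 0")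
    case True
    then show ?thesis using * n by (simp add: r_def)
  next
    case False
    have int: "u integrable_on {-pi..pi}" using u by blast
    have i1: "u integrable_on {-pi..r + pi}" "u integrable_on {r + pi..pi}"
      using False n by (auto intro: integrable_subinterval_real[OF int] simp: r_def)
    have "I = integral {-pi..r + pi} u + integral {r + pi..pi} u"
      using Henstock_Kurzweil_Integration.integral_combine[OF _ _ int, of "r + pi"] False n u
      by (simp add: integral_unique r_def)
    moreover have "((\<lambda>x. u (x + 2 * pi)) has_integral integral {r + pi..pi} u)
        {r + pi - 2 * pi..pi - 2 * pi}"
      by (intro has_integral_shift_real integrable_integral i1)
    then have "(u has_integral integral {r + pi..pi} u) {r - pi..-pi}"
      using periodic_2pi_shift(2)[OF per] by simp
    ultimately show ?thesis
      using has_integral_combine[of "r - pi" "-pi" "r + pi" u] integrable_integral[OF i1(1)] False n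
      by (simp add: add.commute r_def)
  qed
  have "((\<lambda>x. u (x + 2 * pi * of_int n)) has_integral I)
      {r - pi - 2 * pi * of_int n..r + pi - 2 * pi * of_int n}"
    by (rule has_integral_shift_real[OF **])
  then show ?thesis
    using periodic_2pi_shift(3)[OF per] by (simp add: r_def algebra_simps)
qed

lemma has_integral_periodic_flip:
  assumes per: "periodic_2pi u" and u: "(u has_integral I) {-pi..pi}"
  shows "((\<lambda>y. u (x - y)) has_integral I) {-pi..pi}"
proof -
  have "((\<lambda>y. u (y + x)) has_integral I) {x - pi - x..x + pi - x}"
    by (intro has_integral_shift_real has_integral_periodic_shift per u)
  then have "((\<lambda>y. u (y + x)) has_integral I) {-pi..pi}" by simp
  then show ?thesis
    using has_integral_reflect_real[of "\<lambda>y. u (y + x)" I pi "-pi"] by (simp add: add.commute)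
qed

lemma integral_periodic_flip:
  assumes per: "periodic_2pi u" and u: "u integrable_on {-pi..pi}"
  shows "integral {-pi..pi} (\<lambda>y. u (x - y)) = integral {-pi..pi} u"
  using has_integral_periodic_flip[OF per integrable_integral[OF u]] by (rule integral_unique)

lemma periodic_2pi_cos_sin:
  "periodic_2pi (\<lambda>x. cos (of_int n * x))" "periodic_2pi (\<lambda>x. sin (of_int n * x))"
  "periodic_2pi (\<lambda>x. cos (real k * x))" "periodic_2pi (\<lambda>x. sin (real k * x))"
proof -
  show 1: "periodic_2pi (\<lambda>x. cos (of_int n * x))" "periodic_2pi (\<lambda>x. sin (of_int n * x))" for n
  proof -
    have "of_int n * (x + 2 * pi) = of_int n * x + 2 * pi * of_int n" for x
      by (simp add: algebra_simps)
    then show "periodic_2pi (\<lambda>x. cos (of_int n * x))" "periodic_2pi (\<lambda>x. sin (of_int n * x))"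
      unfolding periodic_2pi_def by (simp_all add: cos_add sin_add)
  qed
  show "periodic_2pi (\<lambda>x. cos (real k * x))" "periodic_2pi (\<lambda>x. sin (real k * x))"
    using 1[of "int k"] by simp_all
qed

lemma has_integral_cos_int:
  "((\<lambda>x. cos (of_int n * x)) has_integral (if n = 0 then 2 * pi else 0)) {-pi..pi}"
proof (cases "n = 0")
  case True
  then show ?thesis using has_integral_const_real[of "1::real" "-pi" pi] by simp
next
  case False
  have "((\<lambda>x. cos (of_int n * x)) has_integral
      (sin (of_int n * pi) / of_int n - sin (of_int n * (-pi)) / of_int n)) {-pi..pi}"
    using False
    by (intro fundamental_theorem_of_calculus)
      (auto intro!: derivative_eq_intros simp flip: has_real_derivative_iff_has_vector_derivative)
  moreover have "sin (of_int n * pi) = 0"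
    by (metis mult.commute sin_zero_iff_int2)
  ultimately show ?thesis using False by simp
qed

lemma has_integral_odd:
  fixes f :: "real \<Rightarrow> real"
  assumes "f integrable_on {-pi..pi}" "\<And>x. f (- x) = - f x"
  shows "(f has_integral 0) {-pi..pi}"
proof -
  have "((\<lambda>x. f (- x)) has_integral integral {-pi..pi} f) {-pi..pi}"
    using integrable_integral[OF assms(1)] has_integral_reflect_real[of f _ pi "-pi"] by simp
  then have "((\<lambda>x. f x) has_integral - integral {-pi..pi} f) {-pi..pi}"
    using has_integral_neg[of "\<lambda>x. f (- x)"] assms(2) by fastforce
  then have "integral {-pi..pi} f = - integral {-pi..pi} f" by (rule integral_unique)
  then show ?thesis using assms(1) by (simp add: has_integral_iff)
qed

section \<open>The Dirichlet and Fejer kernels\<close>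

definition dirichlet_kernel :: "nat \<Rightarrow> real \<Rightarrow> real" where
  "dirichlet_kernel k u = (\<Sum>j\<le>k. (if j = 0 then 1 else 2) * cos (real j * u))"

text \<open>Not normalised: the Fejer kernel proper is \<open>fejer_kernel k u / (k + 1)\<close>.\<close>
definition fejer_kernel :: "nat \<Rightarrow> real \<Rightarrow> real" where
  "fejer_kernel k u = (\<Sum>i\<le>k. dirichlet_kernel i u)"

text \<open>Multiplying by \<open>1 - cos u\<close> instead of dividing by it keeps the formula
  valid at the multiples of 2 pi, and the right-hand side telescopes when summed to the Fejer
  kernel.\<close>

lemma dirichlet_kernel_closed: "dirichlet_kernel k u * (1 - cos u) = cos (real k * u) - cos (real (Suc k) * u)"
proof (induction k)
  case 0
  then show ?case by (simp add: dirichlet_kernel_def)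
next
  case (Suc k)
  have "cos (real (Suc k) * u + u) + cos (real (Suc k) * u - u) = 2 * cos (real (Suc k) * u) * cos u"
    unfolding cos_add cos_diff by simp
  moreover have "real (Suc k) * u + u = real (Suc (Suc k)) * u" "real (Suc k) * u - u = real k * u"
    by (simp_all add: algebra_simps)
  ultimately have "cos (real (Suc (Suc k)) * u) + cos (real k * u) = 2 * cos (real (Suc k) * u) * cos u"
    by simp
  moreover have "dirichlet_kernel (Suc k) u = dirichlet_kernel k u + 2 * cos (real (Suc k) * u)"
    by (simp add: dirichlet_kernel_def)
  ultimately show ?case using Suc.IH by (simp add: algebra_simps del: of_nat_Suc)
qed

lemma fejer_kernel_closed: "fejer_kernel k u * (1 - cos u) = 1 - cos (real (Suc k) * u)"
proof -
  have "fejer_kernel k u * (1 - cos u) = (\<Sum>i\<le>k. cos (real i * u) - cos (real (Suc i) * u))"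
    by (simp only: fejer_kernel_def sum_distrib_right dirichlet_kernel_closed)
  also have "\<dots> = 1 - cos (real (Suc k) * u)"
    by (subst sum_telescope) simp
  finally show ?thesis .
qed

text \<open>Where \<open>1 - cos u\<close> is positive the closed form gives the sign; where it
  vanishes all cosines in the definition equal 1.\<close>

lemma fejer_kernel_nonneg: "fejer_kernel k u \<ge> 0"
proof (cases "cos u = 1")
  case True
  then obtain n :: int where n: "u = of_int n * 2 * pi" by (auto simp: cos_one_2pi_int)
  have "cos (real j * u) = 1" for j
    using cos_int_2pin[of "int j * n"] by (simp add: n algebra_simps)
  then show ?thesis unfolding fejer_kernel_def dirichlet_kernel_def by (auto intro!: sum_nonneg)
next
  case False
  then have "1 - cos u > 0" using cos_le_one[of u] by linarith
  moreover have "fejer_kernel k u * (1 - cos u) \<ge> 0" by (simp add: fejer_kernel_closed)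
  ultimately show ?thesis by (simp add: zero_le_mult_iff)
qed

lemma continuous_on_fejer_kernel [continuous_intros]:
  fixes g :: "'a::t2_space \<Rightarrow> real"
  shows "continuous_on A g \<Longrightarrow> continuous_on A (\<lambda>x. fejer_kernel k (g x))"
  unfolding fejer_kernel_def dirichlet_kernel_def
  by (intro continuous_intros)

lemma fejer_kernel_even: "fejer_kernel k (- u) = fejer_kernel k u"
  by (simp add: fejer_kernel_def dirichlet_kernel_def)

lemma periodic_fejer_kernel: "periodic_2pi (fejer_kernel k)"
  using periodic_2pi_cos_sin(3) by (simp add: fejer_kernel_def dirichlet_kernel_def periodic_2pi_def)

text \<open>The truncated subtraction is intended: frequencies above k get coefficient 0, the others
  the triangular weight k + 1 - j. It comes from counting the Dirichlet kernels of order at most k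
  that contain the frequency j.\<close>

lemma has_integral_fejer_kernel_cos:
  "((\<lambda>u. fejer_kernel k u * cos (real j * u)) has_integral (2 * pi * real (Suc k - j))) {-pi..pi}"
proof -
  have 1: "((\<lambda>u. (if i = 0 then 1 else 2) * cos (real i * u) * cos (real j * u)) has_integral
      (if i = j then 2 * pi else 0)) {-pi..pi}" for i
  proof -
    have "cos (real i * u) * cos (real j * u) =
        (cos (of_int (int i - int j) * u) + cos (of_int (int i + int j) * u)) / 2" for u
      by (simp add: cos_times_cos left_diff_distrib distrib_right)
    moreover have "((\<lambda>u. (cos (of_int (int i - int j) * u) + cos (of_int (int i + int j) * u)) / 2)
        has_integral ((if int i - int j = 0 then 2 * pi else 0) +
          (if int i + int j = 0 then 2 * pi else 0)) / 2) {-pi..pi}"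
      by (intro has_integral_divide has_integral_add has_integral_cos_int)
    ultimately have "((\<lambda>u. cos (real i * u) * cos (real j * u)) has_integral
        ((if int i - int j = 0 then 2 * pi else 0) + (if int i + int j = 0 then 2 * pi else 0)) / 2) {-pi..pi}"
      by (simp only:)
    from has_integral_mult_right[OF this, of "if i = 0 then 1 else 2"]
    show ?thesis by (cases "i = j"; cases "i = 0"; cases "j = 0") (simp_all add: mult.assoc)
  qed
  have 2: "((\<lambda>u. dirichlet_kernel i u * cos (real j * u)) has_integral
      (if j \<le> i then 2 * pi else 0)) {-pi..pi}" for i
  proof -
    have "((\<lambda>u. \<Sum>n\<le>i. (if n = 0 then 1 else 2) * cos (real n * u) * cos (real j * u)) has_integral
      (\<Sum>n\<le>i. if n = j then 2 * pi else 0)) {-pi..pi}"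
      by (intro has_integral_sum 1) auto
    then show ?thesis by (simp add: dirichlet_kernel_def sum_distrib_right)
  qed
  have "((\<lambda>u. \<Sum>i\<le>k. dirichlet_kernel i u * cos (real j * u)) has_integral
      (\<Sum>i\<le>k. if j \<le> i then 2 * pi else 0)) {-pi..pi}"
    by (intro has_integral_sum 2) auto
  moreover have "(\<Sum>i\<le>k. if j \<le> i then 2 * pi else 0) = 2 * pi * real (Suc k - j)"
    by (induction k) (auto simp: algebra_simps of_nat_diff Suc_diff_le)
  ultimately show ?thesis by (simp add: fejer_kernel_def sum_distrib_right)
qed

lemma has_integral_fejer_kernel: "(fejer_kernel k has_integral (2 * pi * real (Suc k))) {-pi..pi}"
  using has_integral_fejer_kernel_cos[of k 0] by simp

lemma has_integral_fejer_kernel_sin: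
  "((\<lambda>u. fejer_kernel k u * sin (c * u)) has_integral 0) {-pi..pi}"
  by (intro has_integral_odd integrable_continuous_real continuous_intros) (simp add: fejer_kernel_even)

subsection \<open>Fejer means and Bernstein's inequality\<close>

definition fejer :: "nat \<Rightarrow> (real \<Rightarrow> real) \<Rightarrow> real \<Rightarrow> real" where
  "fejer k f x = integral {-pi..pi} (\<lambda>u. fejer_kernel k u * f (x - u)) / (2 * pi * real (Suc k))"

lemma fejer_integrable:
  assumes "continuous_on UNIV f"
  shows "(\<lambda>u. fejer_kernel k u * f (x - u)) integrable_on {-pi..pi}"
  by (intro integrable_continuous_real continuous_intros continuous_on_compose2[OF assms]) auto

text \<open>Nonnegativity and the total mass 2 pi (k + 1) give this bound. It is the common source
  of the sup and Hoelder bounds for Fejer means and of Bernstein's inequality.\<close>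

lemma fejer_kernel_average_le:
  assumes w: "continuous_on {-pi..pi} w" and M: "\<And>u. \<bar>w u\<bar> \<le> M"
  shows "\<bar>integral {-pi..pi} (\<lambda>u. fejer_kernel k u * w u)\<bar> \<le> M * (2 * pi * real (Suc k))"
proof -
  have "norm (integral {-pi..pi} (\<lambda>u. fejer_kernel k u * w u)) \<le>
      integral {-pi..pi} (\<lambda>u. M * fejer_kernel k u)"
    using M fejer_kernel_nonneg
    by (intro integral_norm_bound_integral integrable_continuous_real continuous_intros w)
      (auto simp: abs_mult mult.commute[of M] intro!: mult_left_mono)
  also have "\<dots> = M * (2 * pi * real (Suc k))"
    by (rule integral_unique[OF has_integral_mult_right[OF has_integral_fejer_kernel]])
  finally show ?thesis by simp
qed

lemma fejer_bound:
  assumes f: "continuous_on UNIV f" and M: "\<And>x. \<bar>f x\<bar> \<le> M"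
  shows "\<bar>fejer k f x\<bar> \<le> M"
proof -
  have "\<bar>integral {-pi..pi} (\<lambda>u. fejer_kernel k u * f (x - u))\<bar> \<le> M * (2 * pi * real (Suc k))"
    by (intro fejer_kernel_average_le continuous_intros continuous_on_compose2[OF f] M) auto
  then show ?thesis by (simp add: fejer_def abs_divide divide_le_eq del: of_nat_Suc)
qed

lemma fejer_diff:
  assumes "continuous_on UNIV f" "continuous_on UNIV g"
  shows "fejer k (\<lambda>x. f x - g x) x = fejer k f x - fejer k g x"
  using integral_diff[OF fejer_integrable[OF assms(1)] fejer_integrable[OF assms(2)]]
  by (simp add: fejer_def right_diff_distrib diff_divide_distrib)

lemma fejer_0: "fejer 0 f x = integral {-pi..pi} (\<lambda>u. f (x - u)) / (2 * pi)"
  by (simp add: fejer_def fejer_kernel_def dirichlet_kernel_def)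

text \<open>Averaging commutes with translations, so a modulus of continuity of f is inherited with
  the same constant.\<close>

lemma fejer_holder:
  assumes f: "continuous_on UNIV f" and L: "\<And>x y. \<bar>f x - f y\<bar> \<le> L * \<bar>x - y\<bar> powr \<theta>"
  shows "\<bar>fejer k f x - fejer k f y\<bar> \<le> L * \<bar>x - y\<bar> powr \<theta>"
proof -
  have "fejer k f x - fejer k f y =
      integral {-pi..pi} (\<lambda>u. fejer_kernel k u * (f (x - u) - f (y - u))) / (2 * pi * real (Suc k))"
    using integral_diff[OF fejer_integrable[OF f] fejer_integrable[OF f]]
    by (simp add: fejer_def right_diff_distrib diff_divide_distrib)
  moreover have "\<bar>f (x - u) - f (y - u)\<bar> \<le> L * \<bar>x - y\<bar> powr \<theta>" for u
    using L[of "x - u" "y - u"] by simp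
  then have "\<bar>integral {-pi..pi} (\<lambda>u. fejer_kernel k u * (f (x - u) - f (y - u)))\<bar>
      \<le> L * \<bar>x - y\<bar> powr \<theta> * (2 * pi * real (Suc k))"
    by (intro fejer_kernel_average_le continuous_intros continuous_on_compose2[OF f]) auto
  ultimately show ?thesis by (simp add: abs_divide divide_le_eq del: of_nat_Suc)
qed

lemma fejer_has_derivative:
  assumes "\<And>x. (f has_real_derivative f' x) (at x)" and f': "continuous_on UNIV f'"
  shows "(fejer k f has_real_derivative fejer k f' x) (at x)"
proof -
  have f: "continuous_on UNIV f"
    using assms(1) by (auto intro!: DERIV_isCont continuous_at_imp_continuous_on)
  have "((\<lambda>x. integral (cbox (-pi) pi) (\<lambda>u. fejer_kernel k u * f (x - u))) has_field_derivative
      integral (cbox (-pi) pi) (\<lambda>u. fejer_kernel k u * f' (x - u))) (at x within UNIV)"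
  proof (rule leibniz_rule_field_derivative)
    show "((\<lambda>x. fejer_kernel k t * f (x - t)) has_real_derivative fejer_kernel k t * f' (x - t)) (at x)" for x t
      using assms(1)[of "x - t"] DERIV_shift[of f "f' (x - t)" x "- t"] by (intro DERIV_cmult) simp
    show "continuous_on (UNIV \<times> cbox (- pi) pi) (\<lambda>(x, t). fejer_kernel k t * f' (x - t))"
      unfolding case_prod_beta
      by (intro continuous_intros continuous_on_compose2[OF f']) auto
  qed (use fejer_integrable[OF f] in auto)
  from DERIV_cdivide[OF this, of "2 * pi * real (Suc k)"] show ?thesis
    by (simp add: fejer_def[abs_def])
qed

section \<open>Trigonometric polynomials and Bernstein's inequality\<close>

definition trigpoly :: "nat \<Rightarrow> (real \<Rightarrow> real) \<Rightarrow> bool" where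
  "trigpoly k p \<longleftrightarrow> (\<exists>A B. \<forall>x. p x = (\<Sum>j\<le>k. A j * cos (real j * x) + B j * sin (real j * x)))"

lemma trigpoly_add:
  assumes "trigpoly k p" "trigpoly k q"
  shows "trigpoly k (\<lambda>x. p x + q x)"
proof -
  obtain A B where p: "\<And>x. p x = (\<Sum>j\<le>k. A j * cos (real j * x) + B j * sin (real j * x))"
    using assms(1) by (auto simp: trigpoly_def)
  obtain A' B' where q: "\<And>x. q x = (\<Sum>j\<le>k. A' j * cos (real j * x) + B' j * sin (real j * x))"
    using assms(2) by (auto simp: trigpoly_def)
  show ?thesis unfolding trigpoly_def
    by (rule exI[of _ "\<lambda>j. A j + A' j"], rule exI[of _ "\<lambda>j. B j + B' j"])
      (simp add: p q algebra_simps sum.distrib)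
qed

lemma trigpoly_cmult: "trigpoly k p \<Longrightarrow> trigpoly k (\<lambda>x. c * p x)"
proof -
  assume "trigpoly k p"
  then obtain A B where p: "\<And>x. p x = (\<Sum>j\<le>k. A j * cos (real j * x) + B j * sin (real j * x))"
    by (auto simp: trigpoly_def)
  show ?thesis unfolding trigpoly_def
    by (rule exI[of _ "\<lambda>j. c * A j"], rule exI[of _ "\<lambda>j. c * B j"])
      (simp add: p algebra_simps sum.distrib sum_distrib_left)
qed

lemma trigpoly_harmonic:
  assumes "j \<le> k"
  shows "trigpoly k (\<lambda>x. a * cos (real j * x) + b * sin (real j * x))"
  unfolding trigpoly_def
  using assms
  by (intro exI[of _ "\<lambda>i. if i = j then a else 0"] exI[of _ "\<lambda>i. if i = j then b else 0"])
    (simp add: sum.distrib if_distrib[of "\<lambda>c. c * _"] sum.delta cong: if_cong)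

lemma trigpoly_sum:
  assumes "finite I" "\<And>i. i \<in> I \<Longrightarrow> trigpoly k (p i)"
  shows "trigpoly k (\<lambda>x. \<Sum>i\<in>I. p i x)"
  using assms
proof (induction I rule: finite_induct)
  case empty
  then show ?case using trigpoly_harmonic[of 0 k 0 0] by simp
next
  case (insert i I)
  then show ?case by (simp add: trigpoly_add)
qed

lemma trigpoly_derivative:
  assumes "trigpoly k p"
  shows "(p has_real_derivative deriv p x) (at x)" "trigpoly k (deriv p)"
proof -
  obtain A B where p: "\<And>x. p x = (\<Sum>j\<le>k. A j * cos (real j * x) + B j * sin (real j * x))"
    using assms by (auto simp: trigpoly_def)
  define p' where "p' x = (\<Sum>j\<le>k. (real j * B j) * cos (real j * x) + (- real j * A j) * sin (real j * x))" for x
  have "((\<lambda>x. \<Sum>j\<le>k. A j * cos (real j * x) + B j * sin (real j * x)) has_real_derivative p' x) (at x)" for x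
    unfolding p'_def by (auto intro!: derivative_eq_intros simp: algebra_simps)
  then have *: "(p has_real_derivative p' x) (at x)" for x
    by (simp add: p[abs_def])
  then have "deriv p = p'" by (auto intro!: DERIV_imp_deriv)
  then show "(p has_real_derivative deriv p x) (at x)" "trigpoly k (deriv p)"
    using * unfolding trigpoly_def by (auto simp only: p'_def)
qed

lemma trigpoly_funpow_deriv: "trigpoly k p \<Longrightarrow> trigpoly k ((deriv ^^ n) p)"
  by (induction n) (auto intro: trigpoly_derivative)

lemma trigpoly_continuous: "trigpoly k p \<Longrightarrow> continuous_on A p"
  by (auto intro!: DERIV_isCont continuous_at_imp_continuous_on trigpoly_derivative)

lemma trigpoly_periodic: "trigpoly k p \<Longrightarrow> periodic_2pi p"
  using periodic_2pi_cos_sin(3,4) by (auto simp: trigpoly_def periodic_2pi_def)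

lemma periodic_2pi_mult: "periodic_2pi u \<Longrightarrow> periodic_2pi v \<Longrightarrow> periodic_2pi (\<lambda>x. u x * v x)"
  by (simp add: periodic_2pi_def)

lemma periodic_2pi_reflect:
  assumes "periodic_2pi u"
  shows "periodic_2pi (\<lambda>y. u (x - y))"
proof -
  have "u (x - (y + 2 * pi)) = u (x - y)" for y
    using periodic_2pi_shift(1)[OF assms, of "x - y"] by (simp add: algebra_simps)
  then show ?thesis by (simp add: periodic_2pi_def)
qed

text \<open>Periodicity lets the variable x move from f to the kernel, where the addition theorem
  separates it from the integration variable; the coefficients are then integrals of f against
  cosines and sines.\<close>

lemma trigpoly_fejer:
  assumes per: "periodic_2pi f" and f: "continuous_on UNIV f"
  shows "trigpoly k (fejer k f)"
proof -
  have int: "(\<lambda>y. f y * cos (real j * y)) integrable_on {-pi..pi}"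
    "(\<lambda>y. f y * sin (real j * y)) integrable_on {-pi..pi}" for j
    by (intro integrable_continuous_real continuous_intros continuous_on_subset[OF f]; simp)+
  define A where "A j = integral {-pi..pi} (\<lambda>y. f y * cos (real j * y))" for j
  define B where "B j = integral {-pi..pi} (\<lambda>y. f y * sin (real j * y))" for j
  have "integral {-pi..pi} (\<lambda>u. fejer_kernel k u * f (x - u)) =
      (\<Sum>i\<le>k. \<Sum>j\<le>i. (if j = 0 then 1 else 2) * (A j * cos (real j * x) + B j * sin (real j * x)))" for x
  proof -
    have *: "((\<lambda>y. f y * cos (real j * (x - y))) has_integral
        (A j * cos (real j * x) + B j * sin (real j * x))) {-pi..pi}" for j
    proof -
      have "((\<lambda>y. (f y * cos (real j * y)) * cos (real j * x) + (f y * sin (real j * y)) * sin (real j * x))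
          has_integral (A j * cos (real j * x) + B j * sin (real j * x))) {-pi..pi}"
        unfolding A_def B_def by (intro has_integral_add has_integral_mult_left integrable_integral int)
      then show ?thesis
        by (rule back_subst[of "\<lambda>F. (F has_integral _) _"]) (auto simp: cos_diff right_diff_distrib algebra_simps)
    qed
    have "((\<lambda>y. \<Sum>i\<le>k. \<Sum>j\<le>i. (if j = 0 then 1 else 2) * (f y * cos (real j * (x - y)))) has_integral
      (\<Sum>i\<le>k. \<Sum>j\<le>i. (if j = 0 then 1 else 2) * (A j * cos (real j * x) + B j * sin (real j * x)))) {-pi..pi}"
      by (intro has_integral_sum has_integral_mult_right *) auto
    then have "((\<lambda>y. fejer_kernel k (x - y) * f y) has_integral
      (\<Sum>i\<le>k. \<Sum>j\<le>i. (if j = 0 then 1 else 2) * (A j * cos (real j * x) + B j * sin (real j * x)))) {-pi..pi}"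
      by (rule back_subst[of "\<lambda>F. (F has_integral _) _"])
        (auto simp: fejer_kernel_def dirichlet_kernel_def sum_distrib_right intro!: sum.cong)
    from has_integral_periodic_flip[OF periodic_2pi_mult[OF periodic_2pi_reflect[OF periodic_fejer_kernel] per] this, of x]
    show ?thesis by (simp add: integral_unique)
  qed
  then have "fejer k f = (\<lambda>x. (1 / (2 * pi * real (Suc k))) *
      (\<Sum>i\<le>k. \<Sum>j\<le>i. (if j = 0 then 1 else 2) * (A j * cos (real j * x) + B j * sin (real j * x))))"
    by (simp add: fejer_def fun_eq_iff)
  moreover have "trigpoly k \<dots>"
    by (intro trigpoly_cmult trigpoly_sum trigpoly_harmonic) auto
  ultimately show ?thesis by simp
qed

text \<open>With n = k + 1, multiplication by 2 sin (n u) moves the triangular coefficients of the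
  kernel to the centres n and -n. At a frequency j <= n the tent around n has height n - (n - j) = j
  and the tent around -n has height 0: the weights of differentiation. The derivative of a
  polynomial of degree n is thereby an average against a nonnegative kernel.\<close>

lemma trigpoly_derivative_formula:
  assumes "trigpoly (Suc k) p"
  shows "((\<lambda>u. fejer_kernel k u * (2 * sin (real (Suc k) * u) * p (x - u))) has_integral
    (- 2 * pi * deriv p x)) {-pi..pi}"
proof -
  obtain A B where p: "\<And>x. p x = (\<Sum>j\<le>Suc k. A j * cos (real j * x) + B j * sin (real j * x))"
    using assms by (auto simp: trigpoly_def)
  let ?s = "\<lambda>u. sin (real (Suc k) * u)"
  have c: "((\<lambda>u. fejer_kernel k u * (2 * ?s u * cos (real j * u))) has_integral 0) {-pi..pi}" for j
    by (intro has_integral_odd integrable_continuous_real continuous_intros) (simp add: fejer_kernel_even)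
  have s: "((\<lambda>u. fejer_kernel k u * (2 * ?s u * sin (real j * u))) has_integral 2 * pi * real j) {-pi..pi}"
    if "j \<le> Suc k" for j
  proof -
    have "2 * ?s u * sin (real j * u) = cos (real (Suc k - j) * u) - cos (real (Suc k + j) * u)" for u
    proof -
      have "real (Suc k - j) * u = real (Suc k) * u - real j * u" "real (Suc k + j) * u = real (Suc k) * u + real j * u"
        using that by (simp_all add: of_nat_diff algebra_simps)
      then show ?thesis by (simp add: cos_diff cos_add del: of_nat_Suc)
    qed
    moreover have "((\<lambda>u. fejer_kernel k u * cos (real (Suc k - j) * u) -
        fejer_kernel k u * cos (real (Suc k + j) * u)) has_integral
        (2 * pi * real (Suc k - (Suc k - j)) - 2 * pi * real (Suc k - (Suc k + j)))) {-pi..pi}"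
      by (intro has_integral_diff has_integral_fejer_kernel_cos)
    ultimately show ?thesis using that
      by (simp add: right_diff_distrib del: of_nat_Suc)
  qed
  have h: "((\<lambda>u. fejer_kernel k u * (2 * ?s u * (A j * cos (real j * (x - u)) + B j * sin (real j * (x - u)))))
      has_integral (- 2 * pi * ((real j * B j) * cos (real j * x) + (- real j * A j) * sin (real j * x)))) {-pi..pi}"
    if "j \<le> Suc k" for j
  proof -
    have "((\<lambda>u. (A j * cos (real j * x) + B j * sin (real j * x)) * (fejer_kernel k u * (2 * ?s u * cos (real j * u)))
        + (A j * sin (real j * x) - B j * cos (real j * x)) * (fejer_kernel k u * (2 * ?s u * sin (real j * u))))
        has_integral ((A j * cos (real j * x) + B j * sin (real j * x)) * 0 +
          (A j * sin (real j * x) - B j * cos (real j * x)) * (2 * pi * real j))) {-pi..pi}"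
      by (intro has_integral_add has_integral_mult_right c s that)
    moreover have "(A j * cos (real j * x) + B j * sin (real j * x)) * (fejer_kernel k u * (2 * ?s u * cos (real j * u)))
        + (A j * sin (real j * x) - B j * cos (real j * x)) * (fejer_kernel k u * (2 * ?s u * sin (real j * u))) =
        fejer_kernel k u * (2 * ?s u * (A j * cos (real j * (x - u)) + B j * sin (real j * (x - u))))" for u
      unfolding right_diff_distrib cos_diff sin_diff by (simp add: algebra_simps)
    moreover have "(A j * cos (real j * x) + B j * sin (real j * x)) * 0 +
          (A j * sin (real j * x) - B j * cos (real j * x)) * (2 * pi * real j) =
        - 2 * pi * ((real j * B j) * cos (real j * x) + (- real j * A j) * sin (real j * x))"
      by (simp add: algebra_simps)
    ultimately show ?thesis by (simp only:)
  qed
  have "((\<lambda>u. \<Sum>j\<le>Suc k. fejer_kernel k u *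
      (2 * ?s u * (A j * cos (real j * (x - u)) + B j * sin (real j * (x - u))))) has_integral
      (\<Sum>j\<le>Suc k. - 2 * pi * ((real j * B j) * cos (real j * x) + (- real j * A j) * sin (real j * x)))) {-pi..pi}"
    by (intro has_integral_sum h) auto
  moreover have "(p has_real_derivative
      (\<Sum>j\<le>Suc k. (real j * B j) * cos (real j * x) + (- real j * A j) * sin (real j * x))) (at x)"
    unfolding p[abs_def] by (auto intro!: derivative_eq_intros sum.cong simp: algebra_simps simp del: sum.atMost_Suc)
  then have "deriv p x = (\<Sum>j\<le>Suc k. (real j * B j) * cos (real j * x) + (- real j * A j) * sin (real j * x))"
    by (rule DERIV_imp_deriv)
  ultimately show ?thesis
    by (simp only: p sum_distrib_left)
qed

text \<open>The derivative formula averages 2 sin (k u) p (x - u) against a nonnegative kernel of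
  mass 2 pi k. Bounding the sine by 1 leaves the factor 2 in place of the sharp constant 1.\<close>

lemma bernstein_inequality:
  assumes p: "trigpoly k p" and M: "\<And>x. \<bar>p x\<bar> \<le> M"
  shows "\<bar>deriv p x\<bar> \<le> 2 * real k * M"
proof (cases k)
  case 0
  then obtain c where "\<And>x. p x = c" using p by (auto simp: trigpoly_def)
  then have "p = (\<lambda>_. c)" by auto
  then show ?thesis using 0 by simp
next
  case (Suc n)
  have "\<bar>integral {-pi..pi} (\<lambda>u. fejer_kernel n u * (2 * sin (real (Suc n) * u) * p (x - u)))\<bar>
      \<le> 2 * M * (2 * pi * real (Suc n))"
  proof (rule fejer_kernel_average_le)
    show "continuous_on {-pi..pi} (\<lambda>u. 2 * sin (real (Suc n) * u) * p (x - u))"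
      by (intro continuous_intros continuous_on_compose2[OF trigpoly_continuous[OF p, of UNIV]]) auto
    have "\<bar>2 * sin (real (Suc n) * u)\<bar> * \<bar>p (x - u)\<bar> \<le> 2 * M" for u
      using M[of "x - u"] abs_sin_le_one[of "real (Suc n) * u"] unfolding abs_mult
      by (intro mult_mono) auto
    then show "\<bar>2 * sin (real (Suc n) * u) * p (x - u)\<bar> \<le> 2 * M" for u
      by (simp only: abs_mult)
  qed
  also have "integral {-pi..pi} (\<lambda>u. fejer_kernel n u * (2 * sin (real (Suc n) * u) * p (x - u))) =
      - 2 * pi * deriv p x"
    using trigpoly_derivative_formula p Suc by (intro integral_unique) blast
  finally have "2 * pi * \<bar>deriv p x\<bar> \<le> 2 * pi * (2 * real k * M)"
    using Suc by (simp add: abs_mult algebra_simps)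
  then show ?thesis by (simp only: mult_le_cancel_left_pos[OF mult_pos_pos[OF zero_less_numeral pi_gt_zero]])
qed

lemma bernstein_inequality_funpow:
  assumes p: "trigpoly k p" and M: "\<And>x. \<bar>p x\<bar> \<le> M"
  shows "\<bar>(deriv ^^ n) p x\<bar> \<le> (2 * real k) ^ n * M"
proof (induction n arbitrary: x)
  case (Suc n)
  then show ?case
    using bernstein_inequality[OF trigpoly_funpow_deriv[OF p, of n], of "(2 * real k) ^ n * M" x]
    by (simp add: mult.assoc)
qed (simp add: M)

text \<open>
  The function is replaced by its average over an interval of length \<open>1/k\<close>: Bernstein's
  inequality controls the error, and the average is Lipschitz.
\<close>
lemma fejer_deriv_bound:
  assumes per: "periodic_2pi g" and g: "continuous_on UNIV g" and k: "k \<ge> 1"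
    and \<theta>: "0 \<le> \<theta>" and L: "\<And>x y. \<bar>g x - g y\<bar> \<le> L * \<bar>x - y\<bar> powr \<theta>"
  shows "\<bar>deriv (fejer k g) x\<bar> \<le> 3 * real k powr (1 - \<theta>) * L"
proof -
  have L0: "L \<ge> 0" using L[of 1 0] by simp
  obtain G where "\<forall>x::real. - \<infinity> < ereal x \<longrightarrow> ereal x < \<infinity> \<longrightarrow> (G has_vector_derivative g x) (at x)"
    using einterval_antiderivative[of "- \<infinity>" \<infinity> g] g by (auto simp: continuous_on_eq_continuous_at)
  then have G: "(G has_real_derivative g x) (at x)" for x
    by (simp add: has_real_derivative_iff_has_vector_derivative)
  then have Gs: "((\<lambda>x. G (x + c)) has_real_derivative g (x + c)) (at x)" for x c
    by (simp flip: DERIV_shift)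
  define h where "h = 1 / real k"
  have h: "h > 0" using k by (simp add: h_def)
  define gh where "gh x = (G (x + h) - G x) / h" for x
  have dgh: "(gh has_real_derivative (g (x + h) - g x) / h) (at x)" for x
    unfolding gh_def[abs_def] by (intro DERIV_cdivide DERIV_diff G Gs)
  have cgh: "continuous_on UNIV gh"
    using dgh by (auto intro!: DERIV_isCont continuous_at_imp_continuous_on)
  \<comment> \<open>\<open>G\<close> itself is not periodic when g has nonzero mean; but its
    increment over a period is constant and cancels in the difference quotient.\<close>
  have pgh: "periodic_2pi gh"
  proof -
    have "((\<lambda>x. G (x + 2 * pi) - G x) has_real_derivative 0) (at x)" for x
    proof -
      have "((\<lambda>x. G (x + 2 * pi) - G x) has_real_derivative (g (x + 2 * pi) - g x)) (at x)"
        by (intro DERIV_diff G Gs)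
      then show ?thesis using per by (simp add: periodic_2pi_def)
    qed
    then have "G (x + 2 * pi) - G x = G (y + 2 * pi) - G y" for x y
      using DERIV_isconst_all[of "\<lambda>x. G (x + 2 * pi) - G x"] by blast
    from this[of "x + h" x for x] show ?thesis
      unfolding periodic_2pi_def gh_def by (simp add: algebra_simps)
  qed
  have close: "\<bar>g x - gh x\<bar> \<le> L * h powr \<theta>" for x
  proof -
    obtain z where z: "x < z" "z < x + h" "G (x + h) - G x = (x + h - x) * g z"
      using MVT2[of x "x + h" G g] G h by auto
    then have "gh x = g z" using h by (simp add: gh_def)
    then have "\<bar>g x - gh x\<bar> \<le> L * \<bar>x - z\<bar> powr \<theta>" using L by simp
    also have "\<dots> \<le> L * h powr \<theta>"
      using z \<theta> L0 by (intro mult_left_mono powr_mono2) auto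
    finally show ?thesis .
  qed
  have lip: "\<bar>gh x - gh y\<bar> \<le> L * h powr (\<theta> - 1) * \<bar>x - y\<bar> powr 1" for x y
  proof -
    have b: "\<bar>(g (x + h) - g x) / h\<bar> \<le> L * h powr (\<theta> - 1)" for x
    proof -
      have "\<bar>(g (x + h) - g x) / h\<bar> = \<bar>g (x + h) - g x\<bar> / h"
        using h by simp
      also have "\<dots> \<le> L * h powr \<theta> / h"
        using L[of "x + h" x] h by (intro divide_right_mono) simp_all
      finally show ?thesis using h by (simp add: powr_diff)
    qed
    have "norm (gh x - gh y) \<le> L * h powr (\<theta> - 1) * norm (x - y)"
      by (rule field_differentiable_bound[of UNIV gh "\<lambda>x. (g (x + h) - g x) / h"])
        (use dgh b in simp_all)
    then show ?thesis by simp
  qed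
  have eq: "fejer k g = (\<lambda>x. fejer k (\<lambda>x. g x - gh x) x + fejer k gh x)"
    using fejer_diff[OF g cgh] by auto
  have per': "periodic_2pi (\<lambda>x. g x - gh x)" and cont': "continuous_on UNIV (\<lambda>x. g x - gh x)"
    using per pgh by (auto simp: periodic_2pi_def intro!: continuous_intros g cgh)
  have t1: "trigpoly k (fejer k (\<lambda>x. g x - gh x))" and t2: "trigpoly k (fejer k gh)"
    by (intro trigpoly_fejer per' cont' pgh cgh)+
  have "deriv (fejer k g) x = deriv (fejer k (\<lambda>x. g x - gh x)) x + deriv (fejer k gh) x"
    by (subst eq) (intro DERIV_imp_deriv DERIV_add trigpoly_derivative(1)[OF t1] trigpoly_derivative(1)[OF t2])
  moreover have "\<bar>deriv (fejer k (\<lambda>x. g x - gh x)) x\<bar> \<le> 2 * real k * (L * h powr \<theta>)"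
    by (intro bernstein_inequality t1 fejer_bound cont' close)
  \<comment> \<open>The choice h = 1/k balances the approximation error, times the Bernstein factor
    2 k, with the Lipschitz constant of the average. The contributions 2 and 1 add up to the 3 of
    the statement.\<close>
  moreover have "2 * real k * (L * h powr \<theta>) = 2 * (real k powr (1 - \<theta>) * L)"
    "L * h powr (\<theta> - 1) = real k powr (1 - \<theta>) * L"
    using k by (simp_all add: h_def powr_divide powr_diff)
  \<comment> \<open>The mean inherits the Lipschitz constant of \<open>gh\<close>, and a Lipschitz
    constant bounds the limit of difference quotients; Bernstein's inequality would lose a factor k
    here.\<close>
  moreover have "\<bar>deriv (fejer k gh) x\<bar> \<le> L * h powr (\<theta> - 1)"
  proof -
    have "((\<lambda>y. (fejer k gh y - fejer k gh x) / (y - x)) \<longlongrightarrow> deriv (fejer k gh) x) (at x)"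
      using trigpoly_derivative(1)[OF t2] by (simp add: has_field_derivative_iff)
    then have "((\<lambda>y. \<bar>(fejer k gh y - fejer k gh x) / (y - x)\<bar>) \<longlongrightarrow> \<bar>deriv (fejer k gh) x\<bar>) (at x)"
      by (rule tendsto_rabs)
    moreover have "\<bar>(fejer k gh y - fejer k gh x) / (y - x)\<bar> \<le> L * h powr (\<theta> - 1)" if "y \<noteq> x" for y
      using fejer_holder[OF cgh lip, of k y x] that by (simp add: abs_divide divide_le_eq)
    ultimately show ?thesis
      by (intro tendsto_upperbound[of _ _ "at x"]) (auto simp: eventually_at_filter)
  qed
  ultimately show ?thesis by linarith
qed

text \<open>The first derivative gains the exponent \<theta>; each further one costs 2 k by
  Bernstein. The case n = 0 must be excluded: a nonzero constant g satisfies the hypothesis with L =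
  0.\<close>

lemma fejer_funpow_deriv_bound:
  assumes per: "periodic_2pi g" and g: "continuous_on UNIV g" and k: "k \<ge> 1"
    and \<theta>: "0 \<le> \<theta>" and L: "\<And>x y. \<bar>g x - g y\<bar> \<le> L * \<bar>x - y\<bar> powr \<theta>"
    and n: "n \<ge> 1"
  shows "\<bar>(deriv ^^ n) (fejer k g) x\<bar> \<le> 3 * 2 ^ n * real k powr (real n - \<theta>) * L"
proof -
  obtain i where i: "n = Suc i" using n by (cases n) auto
  have L0: "L \<ge> 0" using L[of 1 0] by simp
  have "\<bar>(deriv ^^ i) (deriv (fejer k g)) x\<bar> \<le> (2 * real k) ^ i * (3 * real k powr (1 - \<theta>) * L)"
    by (intro bernstein_inequality_funpow trigpoly_derivative trigpoly_fejer per g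
        fejer_deriv_bound[OF per g k \<theta> L])
  also have "\<dots> = 3 * 2 ^ i * (real k powr real i * real k powr (1 - \<theta>)) * L"
    using k by (simp add: power_mult_distrib powr_realpow)
  also have "real k powr real i * real k powr (1 - \<theta>) = real k powr (real n - \<theta>)"
    by (simp add: i add_diff_eq algebra_simps flip: powr_add)
  finally have "\<bar>(deriv ^^ n) (fejer k g) x\<bar> \<le> 3 * 2 ^ i * real k powr (real n - \<theta>) * L"
    by (simp add: i funpow_Suc_right del: funpow.simps)
  also have "\<dots> \<le> 3 * 2 ^ n * real k powr (real n - \<theta>) * L"
    using L0 by (intro mult_right_mono) (auto simp: i)
  finally show ?thesis .
qed

text \<open>Interpolation at the scale 1/k. Points closer than that are compared through the
  derivative of order n + 1, points further apart through twice the sup of the derivative of order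
  n; in both cases the surplus is a power of k |x - y| with the favourable sign.\<close>

lemma fejer_funpow_deriv_holder:
  assumes per: "periodic_2pi g" and g: "continuous_on UNIV g" and k: "k \<ge> 1"
    and \<theta>: "0 \<le> \<theta>" and L: "\<And>x y. \<bar>g x - g y\<bar> \<le> L * \<bar>x - y\<bar> powr \<theta>"
    and \<theta>': "0 < \<theta>'" "\<theta>' < 1" and n: "0 \<le> real n + \<theta>' - \<theta>"
  shows "\<bar>(deriv ^^ n) (fejer k g) x - (deriv ^^ n) (fejer k g) y\<bar> \<le>
    12 * 2 ^ n * real k powr (real n + \<theta>' - \<theta>) * L * \<bar>x - y\<bar> powr \<theta>'"
proof (cases "x = y")
  case False
  define h where "h = \<bar>x - y\<bar>"
  have h: "h > 0" using False by (simp add: h_def)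
  have L0: "L \<ge> 0" using L[of 1 0] by simp
  have kp: "real k > 0" using k by simp
  let ?q = "(deriv ^^ n) (fejer k g)"
  let ?K = "real k powr (real n + \<theta>' - \<theta>)"
  have t: "trigpoly k ?q" by (intro trigpoly_funpow_deriv trigpoly_fejer per g)
  show ?thesis
  proof (cases "h * real k \<le> 1")
    case True
    have "norm (?q x - ?q y) \<le> (3 * 2 ^ Suc n * real k powr (real (Suc n) - \<theta>) * L) * norm (x - y)"
    proof (rule field_differentiable_bound[of UNIV ?q "(deriv ^^ Suc n) (fejer k g)"])
      show "norm ((deriv ^^ Suc n) (fejer k g) z) \<le> 3 * 2 ^ Suc n * real k powr (real (Suc n) - \<theta>) * L" for z
        using fejer_funpow_deriv_bound[OF per g k \<theta> L, of "Suc n" z] by simp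
    qed (use trigpoly_derivative[OF t] in auto)
    also have "\<dots> = 6 * 2 ^ n * L * (real k powr (real (Suc n) - \<theta>) * h)"
      by (simp add: h_def)
    also have "real k powr (real (Suc n) - \<theta>) * h = ?K * h powr \<theta>' * (h * real k) powr (1 - \<theta>')"
      using h kp by (simp add: powr_mult powr_diff powr_add field_simps)
    also have "(h * real k) powr (1 - \<theta>') \<le> 1"
      using True h kp \<theta>' powr_le1[of "1 - \<theta>'" "h * real k"] by simp
    finally have "\<bar>?q x - ?q y\<bar> \<le> 6 * 2 ^ n * L * (?K * h powr \<theta>' * 1)"
      using L0 by (simp add: mult_left_mono)
    also have "\<dots> \<le> 12 * 2 ^ n * ?K * L * h powr \<theta>'"
      using L0 by (simp add: mult_right_mono)
    finally show ?thesis by (simp add: h_def)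
  next
    case False
    have "\<bar>?q x - ?q y\<bar> \<le> 12 * 2 ^ n * L * (?K * h powr \<theta>')"
    proof (cases "n = 0")
      case True
      \<comment> \<open>Without a derivative the sup bound carries no gain in k. The Hoelder
        continuity of g replaces it, and h k > 1 allows the exponent to be raised from \<theta> to
        \<theta>'.\<close>
      then have \<theta>\<theta>: "\<theta>' \<ge> \<theta>" using n by simp
      have "\<bar>?q x - ?q y\<bar> \<le> L * h powr \<theta>"
        using fejer_holder[OF g L, of k x y] True by (simp add: h_def)
      also have "\<dots> \<le> L * (h powr \<theta> * (h * real k) powr (\<theta>' - \<theta>))"
        using False \<theta>\<theta> L0 by (intro mult_left_mono) (auto intro!: ge_one_powr_ge_zero simp: mult_le_cancel_left1)
      also have "\<dots> = L * (?K * h powr \<theta>')"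
        using h kp True by (simp add: powr_mult powr_diff)
      also have "\<dots> \<le> 12 * 2 ^ n * L * (?K * h powr \<theta>')"
        using L0 True by (simp add: mult_right_mono)
      finally show ?thesis .
    next
      case n1: False
      have "\<bar>?q x - ?q y\<bar> \<le> 2 * (3 * 2 ^ n * real k powr (real n - \<theta>) * L)"
        using fejer_funpow_deriv_bound[OF per g k \<theta> L, of n x] fejer_funpow_deriv_bound[OF per g k \<theta> L, of n y] n1
        by linarith
      also have "\<dots> \<le> 6 * 2 ^ n * L * (real k powr (real n - \<theta>) * (h * real k) powr \<theta>')"
        using False \<theta>' L0 ge_one_powr_ge_zero[of "h * real k" \<theta>']
        mult_left_mono[of 1 "(h * real k) powr \<theta>'" "6 * 2 ^ n * L * real k powr (real n - \<theta>)"]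
        by (simp add: algebra_simps)
      also have "real k powr (real n - \<theta>) * (h * real k) powr \<theta>' = ?K * h powr \<theta>'"
        using h kp by (simp add: powr_mult powr_diff powr_add)
      also have "6 * 2 ^ n * L * (?K * h powr \<theta>') \<le> 12 * 2 ^ n * L * (?K * h powr \<theta>')"
        using L0 by (simp add: mult_right_mono)
      finally show ?thesis .
    qed
    then show ?thesis by (simp add: h_def mult.assoc mult.left_commute mult.commute)
  qed
qed auto

subsection \<open>Hoelder norms of series of Fejer means\<close>

text \<open>\<open>deriv\<close> chooses among all candidates for the derivative, and the candidates
  at x and at x + 2 pi are the same. So the choices coincide even where f is not
  differentiable.\<close>

lemma periodic_2pi_deriv:
  assumes "periodic_2pi f"
  shows "periodic_2pi (deriv f)"
proof -
  have "(\<lambda>x. f (x + 2 * pi)) = f"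
    using assms by (auto simp: periodic_2pi_def)
  then have "(f has_real_derivative D) (at (x + 2 * pi)) \<longleftrightarrow> (f has_real_derivative D) (at x)" for D x
    by (simp add: DERIV_shift)
  then show ?thesis by (simp add: periodic_2pi_def deriv_def)
qed

lemma periodic_2pi_funpow_deriv: "periodic_2pi f \<Longrightarrow> periodic_2pi ((deriv ^^ i) f)"
  by (induction i) (auto intro: periodic_2pi_deriv)

lemma periodic_2pi_bounded:
  assumes per: "periodic_2pi g" and g: "continuous_on UNIV g"
  obtains M where "\<And>x. \<bar>g x\<bar> \<le> M"
proof -
  have "bounded (g ` {-pi..pi})"
    by (intro compact_imp_bounded compact_continuous_image continuous_on_subset[OF g]) auto
  then obtain M where M: "\<And>x. x \<in> {-pi..pi} \<Longrightarrow> \<bar>g x\<bar> \<le> M"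
    unfolding bounded_iff by (metis imageI real_norm_def)
  have "\<bar>g x\<bar> \<le> M" for x
  proof -
    obtain n :: int where "x + 2 * pi * of_int n \<in> {-pi..<pi}" by (rule periodic_2pi_reduce)
    then show ?thesis using M[of "x + 2 * pi * of_int n"] periodic_2pi_shift(3)[OF per] by auto
  qed
  then show thesis by (rule that)
qed

lemma Cn_torus_periodic: "f \<in> Cn_torus n \<Longrightarrow> periodic_2pi f"
  by (simp add: Cn_torus_def)

lemma Cn_torus_continuous: "f \<in> Cn_torus n \<Longrightarrow> i \<le> n \<Longrightarrow> continuous_on A ((deriv ^^ i) f)"
  by (auto simp: Cn_torus_def intro: continuous_on_subset)

lemma Cn_torus_has_derivative:
  "f \<in> Cn_torus n \<Longrightarrow> i < n \<Longrightarrow> ((deriv ^^ i) f has_real_derivative (deriv ^^ Suc i) f x) (at x)"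
  by (simp add: Cn_torus_def DERIV_deriv_iff_real_differentiable)

lemma abs_le_sup_torus:
  assumes f: "f \<in> Cn_torus n" and i: "i \<le> n"
  shows "\<bar>(deriv ^^ i) f x\<bar> \<le> (SUP x. \<bar>(deriv ^^ i) f x\<bar>)"
proof -
  obtain M where "\<And>x. \<bar>(deriv ^^ i) f x\<bar> \<le> M"
    using periodic_2pi_bounded[OF periodic_2pi_funpow_deriv[OF Cn_torus_periodic[OF f]] Cn_torus_continuous[OF f i]]
    by blast
  then show ?thesis by (intro cSUP_upper bdd_aboveI[of _ M]) auto
qed

text \<open>A real supremum dominates its set only if the set is bounded above; Hoelder continuity
  supplies that bound.\<close>

lemma holder_seminorm_bound:
  assumes "holder_continuous s g"
  shows "\<bar>g x - g y\<bar> \<le> holder_seminorm s g * \<bar>x - y\<bar> powr s" "0 \<le> holder_seminorm s g"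
proof -
  obtain L where L: "\<And>x y. \<bar>g x - g y\<bar> \<le> L * \<bar>x - y\<bar> powr s"
    using assms by (auto simp: holder_continuous_def)
  have bdd: "bdd_above ((\<lambda>(x, y). \<bar>g x - g y\<bar> / \<bar>x - y\<bar> powr s) ` {(x, y). x \<noteq> y})"
    using L by (intro bdd_aboveI[of _ L]) (auto simp: divide_le_eq)
  have *: "\<bar>g x - g y\<bar> / \<bar>x - y\<bar> powr s \<le> holder_seminorm s g" if "x \<noteq> y" for x y
    unfolding holder_seminorm_def using cSUP_upper[OF _ bdd, of "(x, y)"] that by simp
  show "\<bar>g x - g y\<bar> \<le> holder_seminorm s g * \<bar>x - y\<bar> powr s"
    using *[of x y] by (cases "x = y") (auto simp: divide_le_eq)
  show "0 \<le> holder_seminorm s g"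
    by (rule order_trans[OF _ *[of 1 0]]) auto
qed

text \<open>For integral \<gamma> the second bound has exponent 0 and merely says that the
  oscillation is at most twice the sup norm, whence the factor 2; on the diagonal it reads 0 <= 0,
  as \<open>0 powr 0 = 0\<close>. The Fejer estimates then apply with \<theta> =
  \<open>frac \<gamma>\<close> for integral and fractional \<gamma> alike.\<close>

lemma holder_space_bounds:
  assumes f: "f \<in> holder_space \<gamma>" and \<gamma>: "0 \<le> \<gamma>"
  shows "\<And>i x. i \<le> nat \<lfloor>\<gamma>\<rfloor> \<Longrightarrow> \<bar>(deriv ^^ i) f x\<bar> \<le> holder_norm \<gamma> f"
    and "\<And>x y. \<bar>(deriv ^^ nat \<lfloor>\<gamma>\<rfloor>) f x - (deriv ^^ nat \<lfloor>\<gamma>\<rfloor>) f y\<bar> \<le>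
      2 * holder_norm \<gamma> f * \<bar>x - y\<bar> powr frac \<gamma>"
    and "0 \<le> holder_norm \<gamma> f"
proof -
  let ?a = "nat \<lfloor>\<gamma>\<rfloor>"
  have C: "f \<in> Cn_torus ?a" using f by (simp add: holder_space_def)
  define s where "s i = (SUP x. \<bar>(deriv ^^ i) f x\<bar>)" for i
  have s: "\<bar>(deriv ^^ i) f x\<bar> \<le> s i" if "i \<le> ?a" for i x
    unfolding s_def by (rule abs_le_sup_torus[OF C that])
  have s0: "0 \<le> s i" if "i \<le> ?a" for i
    using s[OF that] order_trans[OF abs_ge_zero] by blast
  define h where "h = (if \<gamma> \<in> \<nat> then 0 else holder_seminorm (frac \<gamma>) ((deriv ^^ ?a) f))"
  have h0: "0 \<le> h"
    using holder_seminorm_bound(2) f by (auto simp: h_def holder_space_def)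
  have N: "holder_norm \<gamma> f = (\<Sum>i\<le>?a. s i) + h"
    by (simp add: holder_norm_def s_def h_def)
  show b: "\<bar>(deriv ^^ i) f x\<bar> \<le> holder_norm \<gamma> f" if "i \<le> ?a" for i x
  proof -
    have "s i \<le> (\<Sum>i\<le>?a. s i)"
      by (rule member_le_sum) (use s0 that in auto)
    then show ?thesis using s[OF that, of x] h0 N by simp
  qed
  then show N0: "0 \<le> holder_norm \<gamma> f"
    using order_trans[OF abs_ge_zero] by blast
  show "\<bar>(deriv ^^ ?a) f x - (deriv ^^ ?a) f y\<bar> \<le> 2 * holder_norm \<gamma> f * \<bar>x - y\<bar> powr frac \<gamma>" for x y
  proof (cases "\<gamma> \<in> \<nat> \<or> x = y")
    case True
    then have "x = y \<or> frac \<gamma> = 0 \<and> x \<noteq> y" by (auto simp: Nats_altdef2)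
    then show ?thesis using b[of ?a x] b[of ?a y] by (auto simp del: frac_eq_0_iff)
  next
    case False
    then have "\<bar>(deriv ^^ ?a) f x - (deriv ^^ ?a) f y\<bar> \<le> h * \<bar>x - y\<bar> powr frac \<gamma>"
      using f holder_seminorm_bound(1) by (simp add: h_def holder_space_def)
    also have "\<dots> \<le> 2 * holder_norm \<gamma> f * \<bar>x - y\<bar> powr frac \<gamma>"
      using N N0 sum_nonneg[of "{..?a}" s] s0 by (intro mult_right_mono) auto
    finally show ?thesis .
  qed
qed

lemma fejer_funpow_deriv:
  assumes f: "f \<in> Cn_torus n" and i: "i \<le> n"
  shows "(deriv ^^ i) (fejer k f) = fejer k ((deriv ^^ i) f)"
  using i
proof (induction i)
  case (Suc i)
  have "(fejer k ((deriv ^^ i) f) has_real_derivative fejer k ((deriv ^^ Suc i) f) x) (at x)" for x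
    using Suc.prems by (intro fejer_has_derivative Cn_torus_has_derivative[OF f] Cn_torus_continuous[OF f]) auto
  then show ?case
    using Suc by (auto intro!: DERIV_imp_deriv)
qed simp

lemma nat_floor_frac:
  fixes x :: real
  assumes "0 \<le> x"
  shows "real (nat \<lfloor>x\<rfloor>) = x - frac x"
  using assms by (simp add: frac_def)

text \<open>As many derivatives as f possesses are moved onto f; the remaining ones fall on the mean
  and cost powers of k, with \<open>frac \<gamma>\<close> as the exponent gained. Orders up to the
  floor of \<gamma> cost nothing and are absorbed because \<delta> >= 0 makes the power of k at
  least 1. The 24 is the 12 of the interpolation bound times the 2 of
  \<open>holder_space_bounds\<close>.\<close>

lemma fejer_holder_space_bounds:
  fixes \<gamma> \<gamma>' :: real and m :: nat
  assumes f: "f \<in> holder_space \<gamma>" and \<gamma>: "0 \<le> \<gamma>" and \<gamma>': "0 < \<gamma>'" "\<gamma>' \<notin> \<nat>"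
    and \<delta>: "0 \<le> \<gamma>' - \<gamma> + real m" and k: "k \<ge> 1"
  defines "n \<equiv> m + nat \<lfloor>\<gamma>'\<rfloor>"
  defines "B \<equiv> 24 * 2 ^ n * real k powr (\<gamma>' - \<gamma> + real m) * holder_norm \<gamma> f"
  shows "\<And>i x. i \<le> n \<Longrightarrow> \<bar>(deriv ^^ i) (fejer k f) x\<bar> \<le> B"
    and "\<And>x y. \<bar>(deriv ^^ n) (fejer k f) x - (deriv ^^ n) (fejer k f) y\<bar> \<le> B * \<bar>x - y\<bar> powr frac \<gamma>'"
proof -
  let ?a = "nat \<lfloor>\<gamma>\<rfloor>"
  let ?g = "(deriv ^^ ?a) f"
  have C: "f \<in> Cn_torus ?a" using f by (simp add: holder_space_def)
  note per = periodic_2pi_funpow_deriv[OF Cn_torus_periodic[OF C]]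
  note cont = Cn_torus_continuous[OF C]
  note hb = holder_space_bounds[OF f \<gamma>]
  have kr: "real k \<ge> 1" using k by simp
  have rn: "real n = real m + \<gamma>' - frac \<gamma>'"
    using nat_floor_frac[of \<gamma>'] \<gamma>' by (simp add: n_def)
  have ra: "real ?a = \<gamma> - frac \<gamma>" using nat_floor_frac[OF \<gamma>] .
  have f01: "0 < frac \<gamma>'" "frac \<gamma>' < 1" "0 \<le> frac \<gamma>" "frac \<gamma> < 1"
    using \<gamma>' by (auto simp: frac_lt_1 Nats_altdef2)
  have an: "?a \<le> n"
  proof -
    \<comment> \<open>The condition \<delta> >= 0 gives \<gamma> <= m + \<gamma>' < n + 1, which for
      the integer \<open>?a\<close> means \<open>?a \<le> n\<close>.\<close>
    have "real ?a < real n + 1" using rn ra \<delta> f01 by linarith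
    then show ?thesis by linarith
  qed
  have split: "(deriv ^^ i) (fejer k f) = (deriv ^^ (i - ?a)) (fejer k ?g)" if "?a \<le> i" for i
    using that fejer_funpow_deriv[OF C order_refl, of k]
    by (metis comp_apply funpow_add le_add_diff_inverse2)
  have N0: "0 \<le> holder_norm \<gamma> f" by (rule hb(3))
  have K1: "1 \<le> real k powr (\<gamma>' - \<gamma> + real m)"
    using kr \<delta> by (rule ge_one_powr_ge_zero)
  show "\<bar>(deriv ^^ i) (fejer k f) x\<bar> \<le> B" if i: "i \<le> n" for i x
  proof (cases "i \<le> ?a")
    case True
    have "\<bar>(deriv ^^ i) (fejer k f) x\<bar> \<le> 1 * 1 * holder_norm \<gamma> f"
      unfolding fejer_funpow_deriv[OF C True]
      using hb(1)[OF True] by (simp add: fejer_bound cont True)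
    also have "\<dots> \<le> B"
      unfolding B_def using K1 N0
      by (intro mult_mono) (auto intro: order_trans[OF _ mult_mono[of 1 24 1 "2 ^ n"]])
    finally show ?thesis .
  next
    case False
    then have ia: "?a \<le> i" "i - ?a \<ge> 1" by auto
    have "\<bar>(deriv ^^ i) (fejer k f) x\<bar> \<le>
        3 * 2 ^ (i - ?a) * real k powr (real (i - ?a) - frac \<gamma>) * (2 * holder_norm \<gamma> f)"
      unfolding split[OF ia(1)]
      by (rule fejer_funpow_deriv_bound[OF per cont k f01(3) hb(2) ia(2)]) simp
    also have "\<dots> = 6 * 2 ^ (i - ?a) * real k powr (real (i - ?a) - frac \<gamma>) * holder_norm \<gamma> f"
      by simp
    also have "\<dots> \<le> B"
    proof -
      have "real (i - ?a) - frac \<gamma> \<le> \<gamma>' - \<gamma> + real m"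
      proof -
        have "real i \<le> real n" using i by simp
        then show ?thesis using rn ra f01 ia(1) by (simp only: of_nat_diff)
      qed
      then show ?thesis
        unfolding B_def using N0 kr i
        by (intro mult_right_mono mult_mono powr_mono power_increasing) auto
    qed
    finally show ?thesis .
  qed
  show "\<bar>(deriv ^^ n) (fejer k f) x - (deriv ^^ n) (fejer k f) y\<bar> \<le> B * \<bar>x - y\<bar> powr frac \<gamma>'" for x y
  proof -
    have e: "real (n - ?a) + frac \<gamma>' - frac \<gamma> = \<gamma>' - \<gamma> + real m"
      using rn ra an by (simp add: of_nat_diff)
    have "\<bar>(deriv ^^ n) (fejer k f) x - (deriv ^^ n) (fejer k f) y\<bar> \<le>
      12 * 2 ^ (n - ?a) * real k powr (real (n - ?a) + frac \<gamma>' - frac \<gamma>) * (2 * holder_norm \<gamma> f) * \<bar>x - y\<bar> powr frac \<gamma>'"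
      unfolding split[OF an]
      by (rule fejer_funpow_deriv_holder[OF per cont k f01(3) hb(2) f01(1,2)]) (use e \<delta> in auto)
    also have "\<dots> = 24 * 2 ^ (n - ?a) * real k powr (\<gamma>' - \<gamma> + real m) * holder_norm \<gamma> f * \<bar>x - y\<bar> powr frac \<gamma>'"
      by (simp add: e)
    also have "\<dots> \<le> B * \<bar>x - y\<bar> powr frac \<gamma>'"
      unfolding B_def using N0 by (intro mult_right_mono mult_left_mono power_increasing) auto
    finally show ?thesis .
  qed
qed

section \<open>Integration by parts and distributional derivatives\<close>

lemma integral_by_parts_periodic:
  assumes u: "periodic_2pi u" "\<And>x. (u has_real_derivative u' x) (at x)" "continuous_on UNIV u'"
    and v: "periodic_2pi v" "\<And>x. (v has_real_derivative v' x) (at x)" "continuous_on UNIV v'"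
  shows "integral {-pi..pi} (\<lambda>x. u x * v' x) = - integral {-pi..pi} (\<lambda>x. u' x * v x)"
proof -
  have c: "continuous_on A u" "continuous_on A v" for A
    using u(2) v(2) by (auto intro!: DERIV_isCont continuous_at_imp_continuous_on)
  have int: "(\<lambda>x. u x * v' x) integrable_on {-pi..pi}" "(\<lambda>x. u' x * v x) integrable_on {-pi..pi}"
    by (intro integrable_continuous_real continuous_intros c continuous_on_subset[OF u(3)]
        continuous_on_subset[OF v(3)]; simp)+
  have "((\<lambda>x. u x * v x) has_real_derivative u' x * v x + u x * v' x) (at x within A)" for x A
    using has_field_derivative_at_within[OF DERIV_mult[OF u(2) v(2), of x], of A]
    by (simp add: mult.commute)
  then have "((\<lambda>x. u' x * v x + u x * v' x) has_integral (u pi * v pi - u (-pi) * v (-pi))) {-pi..pi}"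
    by (intro fundamental_theorem_of_calculus) (auto simp flip: has_real_derivative_iff_has_vector_derivative)
  moreover have "u pi = u (-pi)" "v pi = v (-pi)"
    using periodic_2pi_shift(2)[OF u(1), of "-pi"] periodic_2pi_shift(2)[OF v(1), of "-pi"] by simp_all
  ultimately have "integral {-pi..pi} (\<lambda>x. u' x * v x + u x * v' x) = 0"
    by (auto dest: integral_unique)
  then show ?thesis using integral_add[OF int(2,1)] by simp
qed

text \<open>Each of the m integrations by parts contributes a sign, and together these cancel the
  (-1)^m in \<open>distr_deriv\<close>.\<close>

lemma distr_deriv_distr_of:
  assumes G: "G \<in> Cn_torus m" and \<psi>: "\<psi> \<in> test_torus"
  shows "distr_deriv m (distr_of G) \<psi> = distr_of ((deriv ^^ m) G) \<psi>"
proof -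
  have \<psi>n: "\<psi> \<in> Cn_torus n" for n using \<psi> by (simp add: test_torus_def)
  have "i \<le> m \<Longrightarrow> integral {-pi..pi} (\<lambda>x. G x * (deriv ^^ m) \<psi> x) =
      (-1) ^ i * integral {-pi..pi} (\<lambda>x. (deriv ^^ i) G x * (deriv ^^ (m - i)) \<psi> x)" for i
  proof (induction i)
    case (Suc i)
    then have s: "m - i = Suc (m - Suc i)" by simp
    have "integral {-pi..pi} (\<lambda>x. (deriv ^^ i) G x * (deriv ^^ (m - i)) \<psi> x) =
      - integral {-pi..pi} (\<lambda>x. (deriv ^^ Suc i) G x * (deriv ^^ (m - Suc i)) \<psi> x)"
      unfolding s using Suc.prems
      by (intro integral_by_parts_periodic periodic_2pi_funpow_deriv Cn_torus_periodic[OF G]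
          Cn_torus_periodic[OF \<psi>n] Cn_torus_has_derivative[OF G] Cn_torus_continuous[OF G]
          Cn_torus_has_derivative[OF \<psi>n[of "Suc m"]] Cn_torus_continuous[OF \<psi>n[of "Suc m"]]) auto
    then show ?case using Suc by simp
  qed simp
  from this[OF order_refl] show ?thesis
    by (simp add: distr_deriv_def distr_of_def flip: power_mult_distrib)
qed

lemma suminf_abs_le:
  fixes f :: "nat \<Rightarrow> real"
  assumes "\<And>k. \<bar>f k\<bar> \<le> V k" "summable V" "suminf V \<le> S"
  shows "\<bar>suminf f\<bar> \<le> S"
proof -
  have sa: "summable (\<lambda>k. \<bar>f k\<bar>)"
    by (rule summable_comparison_test'[OF assms(2), of 0]) (simp add: assms(1))
  have "\<bar>suminf f\<bar> \<le> (\<Sum>k. \<bar>f k\<bar>)" by (rule summable_rabs[OF sa])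
  also have "\<dots> \<le> suminf V" by (rule suminf_le[OF assms(1) sa assms(2)])
  finally show ?thesis using assms(3) by simp
qed

text \<open>Two majorants are kept apart. \<open>W\<close> covers all orders from 0 on and only
  justifies termwise differentiation; \<open>V\<close> covers the orders m to n that enter the norm
  of the m-th derivative, and its sum is the quantitative bound. A large mean value can thus sit in
  \<open>W\<close> without spoiling the estimate for m >= 1. The norm consists of floor \<gamma>' +
  1 suprema and one seminorm, whence the factor floor \<gamma>' + 2.\<close>

lemma holder_series:
  fixes p :: "nat \<Rightarrow> real \<Rightarrow> real" and \<gamma>' :: real and m :: nat
  assumes \<gamma>': "0 < \<gamma>'" "\<gamma>' \<notin> \<nat>"
  defines "n \<equiv> m + nat \<lfloor>\<gamma>'\<rfloor>"
  assumes p: "\<And>k. trigpoly k (p k)"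
    and W: "\<And>k i x. i \<le> n \<Longrightarrow> \<bar>(deriv ^^ i) (p k) x\<bar> \<le> W k" "summable W"
    and V: "\<And>k i x. m \<le> i \<Longrightarrow> i \<le> n \<Longrightarrow> \<bar>(deriv ^^ i) (p k) x\<bar> \<le> V k"
      "\<And>k x y. \<bar>(deriv ^^ n) (p k) x - (deriv ^^ n) (p k) y\<bar> \<le> V k * \<bar>x - y\<bar> powr frac \<gamma>'"
      "summable V" "suminf V \<le> S"
  shows "holder_norm_le \<gamma>' (distr_deriv m (distr_of (\<lambda>x. \<Sum>k. p k x))) (real (nat \<lfloor>\<gamma>'\<rfloor> + 2) * S)"
proof -
  define G where "G x = (\<Sum>k. p k x)" for x
  define D where "D i x = (\<Sum>k. (deriv ^^ i) (p k) x)" for i x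
  let ?b = "nat \<lfloor>\<gamma>'\<rfloor>"
  have sm: "summable (\<lambda>k. (deriv ^^ i) (p k) x)" if "i \<le> n" for i x
    by (rule summable_comparison_test'[OF W(2), of 0]) (simp add: W(1)[OF that])
  have ul: "uniform_limit UNIV (\<lambda>n x. \<Sum>k<n. (deriv ^^ i) (p k) x) (D i) sequentially" if "i \<le> n" for i
    unfolding D_def using W(1)[OF that] W(2) by (intro Weierstrass_m_test) auto
  have dD: "(D i has_real_derivative D (Suc i) x) (at x)" if "i < n" for i x
    unfolding D_def
  proof (rule has_field_derivative_series'(2))
    show "((deriv ^^ i) (p k) has_real_derivative (deriv ^^ Suc i) (p k) x) (at x)" for k x
      using trigpoly_derivative(1)[OF trigpoly_funpow_deriv[OF p[of k]], of i x] by simp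
    show "uniformly_convergent_on UNIV (\<lambda>n x. \<Sum>k<n. (deriv ^^ Suc i) (p k) x)"
      using ul[of "Suc i"] that by (auto simp: uniformly_convergent_on_def simp del: funpow.simps)
  qed (use sm[of i] that in auto)
  have cD: "continuous_on UNIV (D i)" if "i \<le> n" for i
    by (rule uniform_limit_theorem[OF _ ul[OF that]])
      (auto intro!: always_eventually continuous_on_sum trigpoly_continuous[OF trigpoly_funpow_deriv[OF p]])
  have GD: "(deriv ^^ i) G = D i" if "i \<le> n" for i
    using that
  proof (induction i)
    case 0
    then show ?case by (simp add: G_def[abs_def] D_def[abs_def])
  next
    case (Suc i)
    then show ?case using dD[of i] by (auto intro!: DERIV_imp_deriv)
  qed
  have per: "periodic_2pi G"
    using trigpoly_periodic[OF p] by (simp add: periodic_2pi_def G_def)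
  have diff: "(deriv ^^ i) G differentiable at x" if "i < n" for i x
    using GD[of i] dD[of i x] that real_differentiable_def by auto
  have GC: "G \<in> Cn_torus m"
    using per GD cD diff by (auto simp: Cn_torus_def n_def)
  define g where "g = (deriv ^^ m) G"
  have gi: "(deriv ^^ i) g = D (m + i)" if "i \<le> ?b" for i
    using GD[of "m + i"] that by (simp add: g_def n_def funpow_add add.commute[of m])
  have gC: "g \<in> Cn_torus ?b"
    unfolding Cn_torus_def
  proof (intro CollectI conjI allI impI)
    show "periodic_2pi g" unfolding g_def by (rule periodic_2pi_funpow_deriv[OF per])
    show "(deriv ^^ i) g differentiable at x" if "i < ?b" for i x
      using gi[of i] dD[of "m + i" x] that real_differentiable_def by (auto simp: n_def)
    show "continuous_on UNIV ((deriv ^^ i) g)" if "i \<le> ?b" for i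
      using gi[of i] cD[of "m + i"] that by (auto simp: n_def)
  qed
  have hol: "\<bar>(deriv ^^ ?b) g x - (deriv ^^ ?b) g y\<bar> \<le> S * \<bar>x - y\<bar> powr frac \<gamma>'" for x y
  proof -
    have "(deriv ^^ ?b) g x - (deriv ^^ ?b) g y = (\<Sum>k. (deriv ^^ n) (p k) x - (deriv ^^ n) (p k) y)"
      using suminf_diff[OF sm sm, of n n x y] by (simp add: gi D_def n_def)
    moreover have "\<bar>\<dots>\<bar> \<le> S * \<bar>x - y\<bar> powr frac \<gamma>'"
    proof (rule suminf_abs_le[OF V(2)])
      show "summable (\<lambda>k. V k * \<bar>x - y\<bar> powr frac \<gamma>')" by (intro summable_mult2 V(3))
      show "(\<Sum>k. V k * \<bar>x - y\<bar> powr frac \<gamma>') \<le> S * \<bar>x - y\<bar> powr frac \<gamma>'"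
        using V(4) by (simp add: suminf_mult2[OF V(3), symmetric] mult_right_mono)
    qed
    ultimately show ?thesis by simp
  qed
  have gH: "g \<in> holder_space \<gamma>'"
    using gC hol by (auto simp: holder_space_def holder_continuous_def)
  have "(SUP x. \<bar>(deriv ^^ i) g x\<bar>) \<le> S" if "i \<le> ?b" for i
    using that by (intro cSUP_least) (auto simp: gi D_def n_def intro!: suminf_abs_le[OF V(1) V(3,4)])
  then have "(\<Sum>i\<le>?b. SUP x. \<bar>(deriv ^^ i) g x\<bar>) \<le> (\<Sum>i\<le>?b. S)"
    by (intro sum_mono) auto
  moreover have "holder_seminorm (frac \<gamma>') ((deriv ^^ ?b) g) \<le> S"
    unfolding holder_seminorm_def
    using hol by (intro cSUP_least) (auto simp: divide_le_eq intro: exI[of _ 0] exI[of _ 1])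
  ultimately have "holder_norm \<gamma>' g \<le> real (?b + 2) * S"
    using \<gamma>' by (simp add: holder_norm_def algebra_simps)
  moreover have "distr_deriv m (distr_of G) \<psi> = distr_of g \<psi>" if "\<psi> \<in> test_torus" for \<psi>
    unfolding g_def by (rule distr_deriv_distr_of[OF GC that])
  ultimately show ?thesis
    using gH unfolding holder_norm_le_def G_def[abs_def, symmetric] by blast
qed

lemma deriv_funpow_cmult:
  assumes "trigpoly k p"
  shows "(deriv ^^ i) (\<lambda>x. c * p x) = (\<lambda>x. c * (deriv ^^ i) p x)"
proof (induction i)
  case (Suc i)
  have "((\<lambda>x. c * (deriv ^^ i) p x) has_real_derivative c * deriv ((deriv ^^ i) p) x) (at x)" for x
    by (intro DERIV_cmult trigpoly_derivative(1)[OF trigpoly_funpow_deriv[OF assms]])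
  then show ?case using Suc by (auto intro!: DERIV_imp_deriv)
qed simp

lemma deriv_funpow_const: "(deriv ^^ i) (\<lambda>_. c :: real) = (\<lambda>_. if i = 0 then c else 0)"
  by (induction i) auto

lemma fejer_0_eq:
  assumes "periodic_2pi f" "continuous_on UNIV f"
  shows "fejer 0 f = (\<lambda>_. integral {-pi..pi} f / (2 * pi))"
  using integral_periodic_flip[OF assms(1) integrable_continuous_real[OF continuous_on_subset[OF assms(2)]]]
  by (auto simp: fejer_0)

text \<open>The term k = 0 is \<open>c 0\<close> times the mean of f, and the weighted sum does not
  see it because \<open>0 powr _ = 0\<close>. Hypothesis \<open>c0\<close> lists the ways to control
  it: a derivative removes it, the mean is zero, or \<open>c 0\<close> itself is small.\<close>

lemma fejer_series_holder:
  fixes \<gamma> \<gamma>' :: real and c :: "nat \<Rightarrow> real" and m :: nat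
  assumes f: "f \<in> holder_space \<gamma>" and \<gamma>: "0 \<le> \<gamma>" and \<gamma>': "0 < \<gamma>'" "\<gamma>' \<notin> \<nat>"
    and \<delta>: "0 \<le> \<gamma>' - \<gamma> + real m"
    and c: "summable (\<lambda>k. \<bar>c k\<bar> * real k powr (\<gamma>' - \<gamma> + real m))"
      "(\<Sum>k. \<bar>c k\<bar> * real k powr (\<gamma>' - \<gamma> + real m)) \<le> S"
    and c0: "1 \<le> m \<or> integral {-pi..pi} f = 0 \<or> \<bar>c 0\<bar> \<le> S"
  defines "b \<equiv> nat \<lfloor>\<gamma>'\<rfloor>"
  shows "holder_norm_le \<gamma>' (distr_deriv m (distr_of (\<lambda>x. \<Sum>k. c k * fejer k f x)))
    (real (b + 2) * ((24 * 2 ^ (m + b) + 1) * S * holder_norm \<gamma> f))"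
  unfolding b_def
proof (rule holder_series[OF \<gamma>'])
  define N where "N = holder_norm \<gamma> f"
  let ?C = "24 * 2 ^ (m + nat \<lfloor>\<gamma>'\<rfloor>) * N"
  \<comment> \<open>The first summand vanishes at k = 0, so \<open>d\<close> is the room left for
    the constant term: \<open>\<bar>c 0\<bar> * N\<close> in the qualitative majorant,
    \<open>S * N\<close> in the one that enters the norm.\<close>
  let ?V = "\<lambda>d k. ?C * (\<bar>c k\<bar> * real k powr (\<gamma>' - \<gamma> + real m)) + (if k = 0 then d else 0)"
  have C: "f \<in> Cn_torus (nat \<lfloor>\<gamma>\<rfloor>)" using f by (simp add: holder_space_def)
  have per: "periodic_2pi f" and cont: "continuous_on UNIV f"
    using Cn_torus_periodic[OF C] Cn_torus_continuous[OF C, of 0 UNIV] by simp_all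
  have N0: "0 \<le> N" unfolding N_def by (rule holder_space_bounds(3)[OF f \<gamma>])
  have S0: "0 \<le> S" using suminf_nonneg[OF c(1)] c(2) by simp
  have V: "(?V d) sums (?C * (\<Sum>k. \<bar>c k\<bar> * real k powr (\<gamma>' - \<gamma> + real m)) + d)" for d
    by (intro sums_add sums_mult summable_sums c(1)) (use sums_single[of 0 "\<lambda>_. d"] in simp)
  have sV: "summable (?V d)" for d using V by (rule sums_summable)
  show "summable (?V (\<bar>c 0\<bar> * N))" "summable (?V (S * N))" by (rule sV)+
  have fN: "\<bar>f x\<bar> \<le> N" for x
    using holder_space_bounds(1)[OF f \<gamma>, of 0 x] by (simp add: N_def)
  show t: "trigpoly k (\<lambda>x. c k * fejer k f x)" for k
    by (intro trigpoly_cmult trigpoly_fejer per cont)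
  have dc: "(deriv ^^ i) (\<lambda>x. c k * fejer k f x) x = c k * (deriv ^^ i) (fejer k f) x" for i k x
    by (simp add: deriv_funpow_cmult[OF trigpoly_fejer[OF per cont]])
  have z: "(deriv ^^ i) (fejer 0 f) x = (if i = 0 then integral {-pi..pi} f / (2 * pi) else 0)" for i x
    by (simp add: fejer_0_eq[OF per cont] deriv_funpow_const)
  have z': "\<bar>integral {-pi..pi} f / (2 * pi)\<bar> \<le> N"
    using fejer_bound[OF cont fN, of 0 0] by (simp add: fejer_0_eq[OF per cont])
  have k1: "\<bar>c k * (deriv ^^ i) (fejer k f) x\<bar> \<le> ?V d k" if "k \<ge> 1" "i \<le> m + nat \<lfloor>\<gamma>'\<rfloor>" for k i x d
    using mult_left_mono[OF fejer_holder_space_bounds(1)[OF f \<gamma> \<gamma>' \<delta> that, of x], of "\<bar>c k\<bar>"] that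
    by (simp add: abs_mult N_def algebra_simps)
  show "\<bar>(deriv ^^ i) (\<lambda>x. c k * fejer k f x) x\<bar> \<le> ?V (\<bar>c 0\<bar> * N) k"
    if "i \<le> m + nat \<lfloor>\<gamma>'\<rfloor>" for k i x
    using k1[OF _ that] z' N0 mult_left_mono[OF z', of "\<bar>c 0\<bar>"]
    by (cases "k = 0") (simp_all add: dc z abs_mult)
  show "\<bar>(deriv ^^ i) (\<lambda>x. c k * fejer k f x) x\<bar> \<le> ?V (S * N) k"
    if "m \<le> i" "i \<le> m + nat \<lfloor>\<gamma>'\<rfloor>" for k i x
  proof (cases "k = 0")
    case True
    have "\<bar>c 0\<bar> * \<bar>integral {-pi..pi} f / (2 * pi)\<bar> \<le> S * N" if "i = 0"
      using c0 that \<open>m \<le> i\<close> mult_mono[OF _ z' S0 abs_ge_zero] S0 N0 by auto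
    then show ?thesis using True S0 N0 by (auto simp: dc z abs_mult)
  next
    case False
    then show ?thesis using k1[OF _ that(2)] by (simp add: dc)
  qed
  show "\<bar>(deriv ^^ (m + nat \<lfloor>\<gamma>'\<rfloor>)) (\<lambda>x. c k * fejer k f x) x - (deriv ^^ (m + nat \<lfloor>\<gamma>'\<rfloor>)) (\<lambda>x. c k * fejer k f x) y\<bar>
      \<le> ?V (S * N) k * \<bar>x - y\<bar> powr frac \<gamma>'" for k x y
  proof (cases "k = 0")
    case True
    then show ?thesis using S0 N0 by (simp add: dc z)
  next
    case False
    then have "k \<ge> 1" by simp
    from mult_left_mono[OF fejer_holder_space_bounds(2)[OF f \<gamma> \<gamma>' \<delta> this, of x y], of "\<bar>c k\<bar>"]
    have "\<bar>c k\<bar> * \<bar>(deriv ^^ (m + nat \<lfloor>\<gamma>'\<rfloor>)) (fejer k f) x - (deriv ^^ (m + nat \<lfloor>\<gamma>'\<rfloor>)) (fejer k f) y\<bar>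
        \<le> ?V (S * N) k * \<bar>x - y\<bar> powr frac \<gamma>'"
      using False by (simp add: N_def mult.assoc mult.left_commute)
    then show ?thesis
      by (simp only: dc abs_mult flip: right_diff_distrib)
  qed
  have "?C * (\<Sum>k. \<bar>c k\<bar> * real k powr (\<gamma>' - \<gamma> + real m)) + S * N \<le> ?C * S + S * N"
    using c(2) N0 by (intro add_right_mono mult_left_mono) auto
  then show "suminf (?V (S * N)) \<le> (24 * 2 ^ (m + nat \<lfloor>\<gamma>'\<rfloor>) + 1) * S * holder_norm \<gamma> f"
    unfolding sums_unique[OF V, symmetric] N_def[symmetric] by (simp add: algebra_simps)
qed

subsection \<open>Convolution as a series of Fejer means\<close>

text \<open>Korovkin's argument: uniform continuity and boundedness give |f x - f (x - u)| <= e/2 +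
  B (1 - cos u), and the kernel times 1 - cos u has the bounded integral 2 pi, negligible against
  the total mass 2 pi (k + 1).\<close>

lemma fejer_converges:
  assumes per: "periodic_2pi f" and f: "continuous_on UNIV f" and e: "e > 0"
  obtains k where "\<And>x. \<bar>f x - fejer k f x\<bar> \<le> e"
proof -
  have pi0: "pi > 0" by simp
  \<comment> \<open>With x and u in [-pi, pi] the point x - u ranges over twice the
    interval.\<close>
  have "uniformly_continuous_on {-2 * pi..2 * pi} f"
    by (intro compact_uniformly_continuous continuous_on_subset[OF f]) auto
  then obtain d where d: "d > 0"
    "\<And>x y. x \<in> {-2 * pi..2 * pi} \<Longrightarrow> y \<in> {-2 * pi..2 * pi} \<Longrightarrow> \<bar>y - x\<bar> < d \<Longrightarrow> \<bar>f y - f x\<bar> < e / 2"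
    using e unfolding uniformly_continuous_on_def dist_real_def by (metis half_gt_zero)
  obtain M where M: "\<And>x. \<bar>f x\<bar> \<le> M" using periodic_2pi_bounded[OF per f] by blast
  have M0: "0 \<le> M" using M[of 0] by simp
  define d' where "d' = min d pi"
  have d': "0 < d'" "d' \<le> d" "d' \<le> pi" using d pi0 by (auto simp: d'_def)
  define s where "s = 1 - cos d'"
  have s: "s > 0"
    using cos_monotone_0_pi[of 0 d'] d' by (simp add: s_def)
  \<comment> \<open>Outside |u| < \<open>d'\<close> one has 1 - cos u >= s, so the term with
    \<open>B\<close> alone exceeds the trivial bound 2 M.\<close>
  define B where "B = 2 * M / s"
  have B0: "B \<ge> 0" using M0 s by (simp add: B_def)
  have close: "\<bar>f x - f (x - u)\<bar> \<le> e / 2 + B * (1 - cos u)" if u: "u \<in> {-pi..pi}" for x u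
  proof (cases "\<bar>u\<bar> < d'")
    case True
    obtain n :: int where n: "x + 2 * pi * of_int n \<in> {-pi..<pi}" by (rule periodic_2pi_reduce)
    let ?y = "x + 2 * pi * of_int n"
    have "\<bar>f ?y - f (?y - u)\<bar> < e / 2"
      by (rule d(2)) (use n u True d' in auto)
    moreover have "f ?y = f x" "f (?y - u) = f (x - u)"
      using periodic_2pi_shift(3)[OF per, of x n] periodic_2pi_shift(3)[OF per, of "x - u" n]
      by (simp_all add: algebra_simps)
    moreover have "0 \<le> B * (1 - cos u)" using B0 by simp
    ultimately show ?thesis by linarith
  next
    case False
    have "cos \<bar>u\<bar> \<le> cos d'"
      using False d' u by (intro cos_monotone_0_pi_le) auto
    then have "B * s \<le> B * (1 - cos u)"
      using B0 by (intro mult_left_mono) (auto simp: s_def)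
    moreover have "B * s = 2 * M" using s by (simp add: B_def)
    ultimately show ?thesis using M[of x] M[of "x - u"] e by linarith
  qed
  \<comment> \<open>After division by the mass, the term with \<open>B\<close> contributes B / (k +
    1), which this k makes at most e / 2.\<close>
  obtain k :: nat where "2 * B / e < real k"
    using reals_Archimedean2 by blast
  then have k: "real (Suc k) > 2 * B / e" by simp
  have "\<bar>f x - fejer k f x\<bar> \<le> e" for x
  proof -
    let ?N = "2 * pi * real (Suc k)"
    have N: "?N > 0" by simp
    have i1: "((\<lambda>u. fejer_kernel k u * f x) has_integral ?N * f x) {-pi..pi}"
      by (rule has_integral_mult_left[OF has_integral_fejer_kernel])
    have i2: "((\<lambda>u. fejer_kernel k u * f (x - u)) has_integral ?N * fejer k f x) {-pi..pi}"
      using integrable_integral[OF fejer_integrable[OF f, of k x]] by (simp add: fejer_def)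
    have i3: "((\<lambda>u. fejer_kernel k u * (f x - f (x - u))) has_integral ?N * (f x - fejer k f x)) {-pi..pi}"
      using has_integral_diff[OF i1 i2] by (simp add: right_diff_distrib)
    have "((\<lambda>u. e / 2 * fejer_kernel k u + B * (1 - cos (real (Suc k) * u))) has_integral
        (e / 2 * ?N + B * (2 * pi - 0))) {-pi..pi}"
      using has_integral_cos_int[of 0] has_integral_cos_int[of "int (Suc k)"]
      by (intro has_integral_add has_integral_mult_right has_integral_fejer_kernel has_integral_diff)
        (simp_all del: of_nat_Suc)
    then have i4: "((\<lambda>u. fejer_kernel k u * (e / 2 + B * (1 - cos u))) has_integral
        (e / 2 * ?N + 2 * pi * B)) {-pi..pi}"
      unfolding fejer_kernel_closed[symmetric] by (simp add: algebra_simps)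
    have "norm (integral {-pi..pi} (\<lambda>u. fejer_kernel k u * (f x - f (x - u)))) \<le>
        integral {-pi..pi} (\<lambda>u. fejer_kernel k u * (e / 2 + B * (1 - cos u)))"
    proof (rule integral_norm_bound_integral)
      show "norm (fejer_kernel k u * (f x - f (x - u))) \<le> fejer_kernel k u * (e / 2 + B * (1 - cos u))"
        if "u \<in> {-pi..pi}" for u
        using mult_left_mono[OF close[OF that, of x] fejer_kernel_nonneg[of k u]]
        by (simp add: abs_mult fejer_kernel_nonneg)
    qed (use i3 i4 in blast)+
    then have "?N * \<bar>f x - fejer k f x\<bar> \<le> e / 2 * ?N + 2 * pi * B"
      unfolding integral_unique[OF i3] integral_unique[OF i4] by (simp add: abs_mult del: of_nat_Suc)
    also have "2 * pi * B \<le> e / 2 * ?N"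
    proof -
      have "2 * B \<le> e * real (Suc k)" using k e by (simp add: field_simps)
      from mult_left_mono[OF this, of pi] show ?thesis by (simp add: algebra_simps)
    qed
    finally have "?N * \<bar>f x - fejer k f x\<bar> \<le> ?N * e" by (simp add: algebra_simps)
    then show ?thesis using N by (simp only: mult_le_cancel_left_pos)
  qed
  then show thesis by (rule that)
qed

section \<open>Convolution with integrable kernels\<close>

lemma L1_torus_flip:
  assumes p: "p \<in> L1_torus"
  shows "(\<lambda>y. p (x - y)) absolutely_integrable_on {-pi..pi}"
    and "integral {-pi..pi} (\<lambda>y. \<bar>p (x - y)\<bar>) = integral {-pi..pi} (\<lambda>y. \<bar>p y\<bar>)"
proof -
  have per: "periodic_2pi p" "periodic_2pi (\<lambda>x. \<bar>p x\<bar>)"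
    using p by (auto simp: L1_torus_def periodic_2pi_def)
  have int: "p integrable_on {-pi..pi}" "(\<lambda>x. \<bar>p x\<bar>) integrable_on {-pi..pi}"
    using p by (auto simp: L1_torus_def absolutely_integrable_on_def)
  show "(\<lambda>y. p (x - y)) absolutely_integrable_on {-pi..pi}"
    using has_integral_periodic_flip[OF per(1) integrable_integral[OF int(1)]]
      has_integral_periodic_flip[OF per(2) integrable_integral[OF int(2)]]
    by (auto simp: absolutely_integrable_on_def)
  show "integral {-pi..pi} (\<lambda>y. \<bar>p (x - y)\<bar>) = integral {-pi..pi} (\<lambda>y. \<bar>p y\<bar>)"
    by (rule integral_periodic_flip[OF per(2) int(2)])
qed

lemma absolutely_integrable_mult_continuous:
  fixes p f :: "real \<Rightarrow> real"
  assumes p: "p absolutely_integrable_on {a..b}" and f: "continuous_on {a..b} f"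
  shows "(\<lambda>y. p y * f y) absolutely_integrable_on {a..b}"
proof -
  have "(\<lambda>y. f y * p y) absolutely_integrable_on {a..b}"
    by (intro absolutely_integrable_bounded_measurable_product_real p
        continuous_imp_measurable_on_sets_lebesgue f compact_imp_bounded compact_continuous_image) auto
  then show ?thesis by (simp add: mult.commute)
qed

lemma conv_torus_integrable:
  assumes "p \<in> L1_torus" "continuous_on UNIV f"
  shows "(\<lambda>y. p (x - y) * f y) integrable_on {-pi..pi}"
    "(\<lambda>y. \<bar>p (x - y) * f y\<bar>) integrable_on {-pi..pi}"
  using absolutely_integrable_mult_continuous[OF L1_torus_flip(1)[OF assms(1)] continuous_on_subset[OF assms(2) subset_UNIV], of x]
  by (auto simp: absolutely_integrable_on_def)

lemma conv_torus_bound: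
  assumes p: "p \<in> L1_torus" and f: "continuous_on UNIV f" and M: "\<And>x. \<bar>f x\<bar> \<le> M"
  shows "\<bar>conv_torus p f x\<bar> \<le> M * integral {-pi..pi} (\<lambda>y. \<bar>p y\<bar>)"
proof -
  have int: "(\<lambda>y. \<bar>p (x - y)\<bar>) integrable_on {-pi..pi}"
    using L1_torus_flip(1)[OF p, of x] by (simp add: absolutely_integrable_on_def)
  have "norm (integral {-pi..pi} (\<lambda>y. p (x - y) * f y)) \<le> integral {-pi..pi} (\<lambda>y. \<bar>p (x - y)\<bar> * M)"
    using M by (intro integral_norm_bound_integral conv_torus_integrable p f integrable_on_mult_left int)
      (auto simp: abs_mult intro!: mult_left_mono)
  also have "\<dots> = M * integral {-pi..pi} (\<lambda>y. \<bar>p y\<bar>)"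
    using L1_torus_flip(2)[OF p] by simp
  finally show ?thesis by (simp add: conv_torus_def)
qed

lemma conv_torus_diff:
  assumes "p \<in> L1_torus" "continuous_on UNIV f" "continuous_on UNIV g"
  shows "conv_torus p (\<lambda>x. f x - g x) x = conv_torus p f x - conv_torus p g x"
  using integral_diff[OF conv_torus_integrable(1)[OF assms(1,2)] conv_torus_integrable(1)[OF assms(1,3)]]
  by (simp add: conv_torus_def right_diff_distrib)

text \<open>By the addition theorem a kernel without sine coefficient at frequency j has the
  harmonics of that frequency as eigenfunctions. This applies both to the kernel p and to the Fejer
  kernel itself, so both act as multipliers.\<close>

lemma conv_torus_harmonic:
  assumes p: "p \<in> L1_torus"
    and c: "integral {-pi..pi} (\<lambda>u. p u * cos (real j * u)) = r"
    and s: "integral {-pi..pi} (\<lambda>u. p u * sin (real j * u)) = 0"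
  shows "((\<lambda>y. p (x - y) * (a * cos (real j * y) + b * sin (real j * y))) has_integral
    r * (a * cos (real j * x) + b * sin (real j * x))) {-pi..pi}"
proof -
  let ?C = "\<lambda>u. p u * cos (real j * u)" and ?S = "\<lambda>u. p u * sin (real j * u)"
  let ?a = "a * cos (real j * x) + b * sin (real j * x)"
  let ?b = "a * sin (real j * x) - b * cos (real j * x)"
  have pa: "p absolutely_integrable_on {-pi..pi}" and per: "periodic_2pi p"
    using p by (auto simp: L1_torus_def)
  have "?C absolutely_integrable_on {-pi..pi}" "?S absolutely_integrable_on {-pi..pi}"
    by (intro absolutely_integrable_mult_continuous pa continuous_intros)+
  then have C: "(?C has_integral r) {-pi..pi}" and S: "(?S has_integral 0) {-pi..pi}"
    using c s by (auto simp: has_integral_iff absolutely_integrable_on_def)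
  have "((\<lambda>u. ?a * ?C u + ?b * ?S u) has_integral (?a * r + ?b * 0)) {-pi..pi}"
    by (intro has_integral_add has_integral_mult_right C S)
  moreover have "periodic_2pi (\<lambda>u. ?a * ?C u + ?b * ?S u)"
    using per periodic_2pi_cos_sin(3,4)[of j] by (simp add: periodic_2pi_def)
  ultimately have "((\<lambda>y. ?a * ?C (x - y) + ?b * ?S (x - y)) has_integral (?a * r + ?b * 0)) {-pi..pi}"
    by (rule has_integral_periodic_flip[rotated])
  moreover have "?a * ?C (x - y) + ?b * ?S (x - y) = p (x - y) * (a * cos (real j * y) + b * sin (real j * y))" for y
  proof -
    have "cos (real j * y) = cos (real j * x - real j * (x - y))"
      "sin (real j * y) = sin (real j * x - real j * (x - y))"
      by (simp_all add: algebra_simps)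
    then show ?thesis by (simp only: cos_diff sin_diff) (simp only: algebra_simps)
  qed
  ultimately show ?thesis by (simp add: mult.commute)
qed

lemma fejer_harmonic:
  "fejer k (\<lambda>y. a * cos (real j * y) + b * sin (real j * y)) x =
    real (Suc k - j) / real (Suc k) * (a * cos (real j * x) + b * sin (real j * x))"
proof -
  have fL: "fejer_kernel k \<in> L1_torus"
    using periodic_fejer_kernel
    by (auto simp: L1_torus_def intro!: absolutely_integrable_continuous_real continuous_on_fejer_kernel)
  let ?h = "\<lambda>y. a * cos (real j * y) + b * sin (real j * y)"
  have ph: "periodic_2pi ?h"
    using periodic_2pi_cos_sin(3,4)[of j] by (simp add: periodic_2pi_def)
  have "((\<lambda>y. fejer_kernel k (x - y) * ?h y) has_integral (2 * pi * real (Suc k - j)) * ?h x) {-pi..pi}"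
    using has_integral_fejer_kernel_cos[of k j] has_integral_fejer_kernel_sin[of k "real j"]
    by (intro conv_torus_harmonic fL) (auto dest: integral_unique)
  from has_integral_periodic_flip[OF periodic_2pi_mult[OF periodic_2pi_reflect[OF periodic_fejer_kernel] ph] this, of x]
  have "integral {-pi..pi} (\<lambda>u. fejer_kernel k u * ?h (x - u)) = (2 * pi * real (Suc k - j)) * ?h x"
    by (simp add: integral_unique)
  then show ?thesis by (simp add: fejer_def del: of_nat_Suc)
qed

text \<open>Summation by parts twice, tested on a single frequency j: the Fejer means see it with
  weight (k + 1 - j)^+ / (k + 1), and the second differences reassemble its multiplier. The
  hypothesis makes the boundary terms vanish.\<close>

lemma second_difference_sums:
  fixes r :: "nat \<Rightarrow> real"
  assumes "(\<lambda>k. real k * r k) \<longlonglongrightarrow> 0"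
  shows "(\<lambda>k. real (Suc k - j) * (r k - 2 * r (Suc k) + r (Suc (Suc k)))) sums r j"
proof -
  let ?a = "\<lambda>k. real (Suc k - j) * (r k - 2 * r (Suc k) + r (Suc (Suc k)))"
  have "(\<lambda>k. inverse (real k) * (real k * r k)) \<longlonglongrightarrow> 0 * 0"
    by (intro tendsto_mult lim_inverse_n assms)
  then have r0: "r \<longlonglongrightarrow> 0"
    by (rule Lim_transform_eventually[THEN tendsto_eq_rhs])
      (auto intro!: eventually_sequentiallyI[of 1])
  have partial: "(\<Sum>k<n + j. ?a k) = r j - (real n + 1) * r (n + j) + real n * r (Suc (n + j))" for n
  proof (induction n)
    case 0
    have "(\<Sum>k<j. ?a k) = 0" by (intro sum.neutral) auto
    then show ?case by simp
  next
    case (Suc n)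
    then show ?case by (simp add: algebra_simps)
  qed
  \<comment> \<open>The boundary factors are rewritten as n + 1 = (n + j) + (1 - j) and n = (n + j +
    1) - (1 + j), so that each index meets its own value of r and the hypothesis applies.\<close>
  have "(\<lambda>n. r j - (real (n + j) * r (n + j) + (1 - real j) * r (n + j)) +
      (real (Suc (n + j)) * r (Suc (n + j)) - (1 + real j) * r (Suc (n + j)))) \<longlonglongrightarrow>
      r j - (0 + (1 - real j) * 0) + (0 - (1 + real j) * 0)"
  proof (intro tendsto_intros)
    show "(\<lambda>n. real (n + j) * r (n + j)) \<longlonglongrightarrow> 0" "(\<lambda>n. r (n + j)) \<longlonglongrightarrow> 0"
      by (rule LIMSEQ_ignore_initial_segment[OF assms] LIMSEQ_ignore_initial_segment[OF r0])+
    show "(\<lambda>n. real (Suc (n + j)) * r (Suc (n + j))) \<longlonglongrightarrow> 0" "(\<lambda>n. r (Suc (n + j))) \<longlonglongrightarrow> 0"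
      using LIMSEQ_ignore_initial_segment[OF assms, of "Suc j"] LIMSEQ_ignore_initial_segment[OF r0, of "Suc j"]
      by simp_all
  qed
  then have "(\<lambda>n. \<Sum>k<n + j. ?a k) \<longlonglongrightarrow> r j"
    unfolding partial by (simp add: algebra_simps)
  then show ?thesis
    unfolding sums_def by (rule LIMSEQ_offset)
qed

text \<open>At a fixed x both sides are linear in f and bounded by the sup norm. They agree on
  harmonics by \<open>second_difference_sums\<close>, hence on trigonometric polynomials, which are
  dense by Fejer's theorem. No Fourier inversion for p is involved.\<close>

lemma conv_torus_eq_fejer_series:
  fixes r :: "nat \<Rightarrow> real"
  assumes p: "p \<in> L1_torus"
    and r: "\<And>j. integral {-pi..pi} (\<lambda>u. p u * cos (real j * u)) = r j"
      "\<And>j. integral {-pi..pi} (\<lambda>u. p u * sin (real j * u)) = 0"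
    and r0: "(\<lambda>k. real k * r k) \<longlonglongrightarrow> 0"
  defines "c \<equiv> \<lambda>k. real (Suc k) * (r k - 2 * r (Suc k) + r (Suc (Suc k)))"
  assumes c: "summable (\<lambda>k. \<bar>c k\<bar>)"
    and per: "periodic_2pi f" and f: "continuous_on UNIV f"
  shows "conv_torus p f x = (\<Sum>k. c k * fejer k f x)"
proof -
  have fs: "summable (\<lambda>k. c k * fejer k g x)" "\<bar>\<Sum>k. c k * fejer k g x\<bar> \<le> (\<Sum>k. \<bar>c k\<bar>) * M"
    if g: "continuous_on UNIV g" "\<And>x. \<bar>g x\<bar> \<le> M" for g M
  proof -
    have b: "\<bar>c k * fejer k g x\<bar> \<le> \<bar>c k\<bar> * M" for k
      unfolding abs_mult by (intro mult_left_mono fejer_bound g) auto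
    have sm: "summable (\<lambda>k. \<bar>c k\<bar> * M)" by (rule summable_mult2[OF c])
    show "summable (\<lambda>k. c k * fejer k g x)"
      by (rule summable_comparison_test'[OF sm, of 0]) (simp add: b)
    show "\<bar>\<Sum>k. c k * fejer k g x\<bar> \<le> (\<Sum>k. \<bar>c k\<bar>) * M"
      by (rule suminf_abs_le[OF b sm]) (simp add: suminf_mult2[OF c])
  qed
  have harm: "(\<lambda>k. c k * fejer k (\<lambda>y. a * cos (real j * y) + b * sin (real j * y)) x) sums
      (r j * (a * cos (real j * x) + b * sin (real j * x)))" for a b j
  proof -
    have "c k * fejer k (\<lambda>y. a * cos (real j * y) + b * sin (real j * y)) x =
      real (Suc k - j) * (r k - 2 * r (Suc k) + r (Suc (Suc k))) * (a * cos (real j * x) + b * sin (real j * x))" for k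
      by (simp add: c_def fejer_harmonic del: of_nat_Suc)
    then show ?thesis
      using sums_mult2[OF second_difference_sums[OF r0, of j], of "a * cos (real j * x) + b * sin (real j * x)"]
      by simp
  qed
  have trig: "conv_torus p q x = (\<Sum>k. c k * fejer k q x)" if "trigpoly n q" for n q
  proof -
    obtain A B where q: "q = (\<lambda>x. \<Sum>j\<le>n. A j * cos (real j * x) + B j * sin (real j * x))"
      using \<open>trigpoly n q\<close> by (auto simp: trigpoly_def)
    let ?h = "\<lambda>j y. A j * cos (real j * y) + B j * sin (real j * y)"
    have "((\<lambda>y. \<Sum>j\<le>n. p (x - y) * ?h j y) has_integral (\<Sum>j\<le>n. r j * ?h j x)) {-pi..pi}"
      by (intro has_integral_sum conv_torus_harmonic p r) auto
    then have "conv_torus p q x = (\<Sum>j\<le>n. r j * ?h j x)"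
      by (simp add: conv_torus_def q sum_distrib_left integral_unique)
    moreover have "fejer k q x = (\<Sum>j\<le>n. fejer k (?h j) x)" for k
    proof -
      have "(\<lambda>u. fejer_kernel k u * ?h j (x - u)) integrable_on {-pi..pi}" for j
        by (intro fejer_integrable continuous_intros)
      then show ?thesis
        by (simp add: fejer_def q sum_distrib_left integral_sum sum_divide_distrib del: of_nat_Suc)
    qed
    moreover have "(\<lambda>k. \<Sum>j\<le>n. c k * fejer k (?h j) x) sums (\<Sum>j\<le>n. r j * ?h j x)"
      by (intro sums_sum harm)
    ultimately show ?thesis by (simp add: sums_iff sum_distrib_left)
  qed
  define K where "K = integral {-pi..pi} (\<lambda>y. \<bar>p y\<bar>) + (\<Sum>k. \<bar>c k\<bar>)"
  let ?d = "\<bar>conv_torus p f x - (\<Sum>k. c k * fejer k f x)\<bar>"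
  have "?d \<le> e * K" if e: "e > 0" for e
  proof -
    obtain n where n: "\<And>x. \<bar>f x - fejer n f x\<bar> \<le> e" using fejer_converges[OF per f e] by blast
    define q where "q = fejer n f"
    have tq: "trigpoly n q" unfolding q_def by (rule trigpoly_fejer[OF per f])
    have cq: "continuous_on UNIV q" by (rule trigpoly_continuous[OF tq])
    obtain M where M: "\<And>x. \<bar>f x\<bar> \<le> M" using periodic_2pi_bounded[OF per f] by blast
    have qM: "\<bar>q x\<bar> \<le> M" for x unfolding q_def by (rule fejer_bound[OF f M])
    have cd: "continuous_on UNIV (\<lambda>x. f x - q x)" by (intro continuous_intros f cq)
    have "conv_torus p (\<lambda>x. f x - q x) x = conv_torus p f x - conv_torus p q x"
      by (rule conv_torus_diff[OF p f cq])
    moreover have "\<bar>conv_torus p (\<lambda>x. f x - q x) x\<bar> \<le> e * integral {-pi..pi} (\<lambda>y. \<bar>p y\<bar>)"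
      by (rule conv_torus_bound[OF p cd]) (simp add: q_def n)
    moreover have "(\<Sum>k. c k * fejer k (\<lambda>x. f x - q x) x) = (\<Sum>k. c k * fejer k f x) - (\<Sum>k. c k * fejer k q x)"
      using suminf_diff[OF fs(1)[OF f M] fs(1)[OF cq qM]] by (simp add: fejer_diff[OF f cq] right_diff_distrib)
    moreover have "\<bar>\<Sum>k. c k * fejer k (\<lambda>x. f x - q x) x\<bar> \<le> (\<Sum>k. \<bar>c k\<bar>) * e"
      by (rule fs(2)[OF cd]) (simp add: q_def n)
    ultimately show ?thesis using trig[OF tq] by (simp add: K_def algebra_simps)
  qed
  moreover have "K \<ge> 0"
    unfolding K_def by (intro add_nonneg_nonneg integral_nonneg suminf_nonneg c conv_torus_integrable)
      (use p in \<open>auto simp: L1_torus_def absolutely_integrable_on_def\<close>)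
  ultimately have "?d \<le> e" if "e > 0" for e
  proof -
    \<comment> \<open>Dividing by K + 1 rather than K covers K = 0.\<close>
    have "?d \<le> e / (K + 1) * K" using \<open>\<And>e. e > 0 \<Longrightarrow> ?d \<le> e * K\<close>[of "e / (K + 1)"] that \<open>K \<ge> 0\<close> by simp
    also have "\<dots> \<le> e" using that \<open>K \<ge> 0\<close> by (simp add: divide_le_eq mult_left_mono)
    finally show ?thesis .
  qed
  then have "?d \<le> 0" by (rule field_le_epsilon[of _ 0, simplified])
  then show ?thesis by simp
qed

subsection \<open>Multiplier and symbol estimates\<close>

text \<open>For a real function a real Fourier coefficient has no sine part; the factor sqrt (2 pi)
  undoes the normalisation of the transform.\<close>

lemma fourier_torus_real_coeffs:
  assumes p: "p \<in> L1_torus" and F: "fourier_torus p (int j) = complex_of_real a"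
  shows "((\<lambda>u. p u * cos (real j * u)) has_integral sqrt (2 * pi) * a) {-pi..pi}"
    "((\<lambda>u. p u * sin (real j * u)) has_integral 0) {-pi..pi}"
proof -
  let ?C = "\<lambda>u. p u * cos (real j * u)" and ?S = "\<lambda>u. p u * sin (real j * u)"
  define c s where "c = integral {-pi..pi} ?C" and "s = integral {-pi..pi} ?S"
  have "?C absolutely_integrable_on {-pi..pi}" "?S absolutely_integrable_on {-pi..pi}"
    using p by (auto simp: L1_torus_def intro!: absolutely_integrable_mult_continuous continuous_intros)
  then have C: "(?C has_integral c) {-pi..pi}" and S: "(?S has_integral s) {-pi..pi}"
    by (auto simp: c_def s_def absolutely_integrable_on_def intro!: integrable_integral)
  have "((\<lambda>u. complex_of_real (?C u) - \<i> * complex_of_real (?S u)) has_integral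
      (complex_of_real c - \<i> * complex_of_real s)) {-pi..pi}"
    using has_integral_linear[OF C bounded_linear_of_real] has_integral_linear[OF S bounded_linear_of_real]
    by (intro has_integral_diff has_integral_mult_right) (simp_all add: o_def)
  moreover have "complex_of_real (?C u) - \<i> * complex_of_real (?S u) =
      complex_of_real (p u) * exp (- (\<i> * of_int (int j) * of_real u))" for u
  proof -
    have "exp (- (\<i> * of_int (int j) * of_real u)) = cis (- (real j * u))"
      by (simp add: cis_conv_exp mult.assoc)
    then show ?thesis by (simp add: complex_eq_iff)
  qed
  ultimately have "integral {-pi..pi} (\<lambda>u. complex_of_real (p u) * exp (- (\<i> * of_int (int j) * of_real u))) =
      complex_of_real c - \<i> * complex_of_real s"
    by (simp add: integral_unique)
  then have "complex_of_real a = complex_of_real (1 / sqrt (2 * pi)) * (complex_of_real c - \<i> * complex_of_real s)"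
    using F by (simp add: fourier_torus_def)
  then have "a = c / sqrt (2 * pi) \<and> s / sqrt (2 * pi) = 0"
    by (auto simp: complex_eq_iff)
  then have "c = sqrt (2 * pi) * a" "s = 0" by auto
  then show "(?C has_integral sqrt (2 * pi) * a) {-pi..pi}" "(?S has_integral 0) {-pi..pi}"
    using C S by simp_all
qed

lemma holder_norm_le_mono: "holder_norm_le \<gamma> T B \<Longrightarrow> B \<le> B' \<Longrightarrow> holder_norm_le \<gamma> T B'"
  by (auto simp: holder_norm_le_def intro: order_trans)

text \<open>The first two factors come from \<open>fejer_series_holder\<close>. In the last one,
  sqrt (2 pi) is the Fourier normalisation, 2 stems from k + 1 <= 2 k, the series is zeta (1 +
  \<kappa>) since its term at 0 vanishes, and the 1 provides for the mean value of f.\<close>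

definition multiplier_const :: "real \<Rightarrow> nat \<Rightarrow> nat \<Rightarrow> real" where
  "multiplier_const \<kappa> m b = real (b + 2) * (24 * 2 ^ (m + b) + 1) *
     (2 * sqrt (2 * pi) * (1 + (\<Sum>k. real k powr (-1 - \<kappa>))))"

lemma multiplier_const_pos:
  assumes "\<kappa> > 0"
  shows "multiplier_const \<kappa> m b > 0"
proof -
  have "0 \<le> (\<Sum>k. real k powr (-1 - \<kappa>))"
    using assms by (intro suminf_nonneg) (simp_all add: summable_real_powr_iff)
  then show ?thesis
    unfolding multiplier_const_def by (intro mult_pos_pos) (simp_all add: add_pos_pos add_pos_nonneg)
qed

text \<open>Monotonicity in \<open>b\<close> yields one constant for all admissible \<gamma>', which
  enters only through its integer part.\<close>

lemma multiplier_const_mono: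
  assumes "\<kappa> > 0" "b \<le> b'"
  shows "multiplier_const \<kappa> m b \<le> multiplier_const \<kappa> m b'"
proof -
  have "0 \<le> (\<Sum>k. real k powr (-1 - \<kappa>))"
    using assms(1) by (intro suminf_nonneg) (simp_all add: summable_real_powr_iff)
  then show ?thesis
    unfolding multiplier_const_def using assms(2) by (intro mult_mono) (auto intro!: power_increasing)
qed

text \<open>
  The second differences give \<open>p * f\<close> as a series of Fejer means, whose Hoelder norms grow like
  \<open>k powr (\<gamma>' - \<gamma> + m)\<close>; the exponent \<open>\<kappa>\<close> makes the series converge.
\<close>
lemma holder_multiplier_estimate:
  fixes a :: "nat \<Rightarrow> real" and \<gamma> \<gamma>' \<kappa> A :: real and m :: nat
  assumes p: "p \<in> L1_torus"
    and a: "\<And>j. ((\<lambda>u. p u * cos (real j * u)) has_integral sqrt (2 * pi) * a j) {-pi..pi}"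
      "\<And>j. ((\<lambda>u. p u * sin (real j * u)) has_integral 0) {-pi..pi}"
    and a0: "(\<lambda>k. real k * a k) \<longlonglongrightarrow> 0"
    and A: "0 \<le> A" "\<And>k. k \<ge> 1 \<Longrightarrow> \<bar>a k - 2 * a (Suc k) + a (Suc (Suc k))\<bar> \<le>
        A * real k powr (-2 - (\<gamma>' - \<gamma> + real m + \<kappa>))"
    and \<kappa>: "\<kappa> > 0"
    and f: "f \<in> holder_space \<gamma>" and \<gamma>: "0 \<le> \<gamma>" and \<gamma>': "0 < \<gamma>'" "\<gamma>' \<notin> \<nat>"
    and \<delta>: "0 \<le> \<gamma>' - \<gamma> + real m"
    and A0: "1 \<le> m \<or> integral {-pi..pi} f = 0 \<or> \<bar>a 0 - 2 * a 1 + a 2\<bar> \<le> A"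
  shows "holder_norm_le \<gamma>' (distr_deriv m (distr_of (conv_torus p f)))
    (multiplier_const \<kappa> m (nat \<lfloor>\<gamma>'\<rfloor>) * A * holder_norm \<gamma> f)"
proof -
  define \<delta> where "\<delta> = \<gamma>' - \<gamma> + real m"
  define c where "c k = real (Suc k) * (sqrt (2 * pi) * a k - 2 * (sqrt (2 * pi) * a (Suc k)) + sqrt (2 * pi) * a (Suc (Suc k)))" for k
  define Z where "Z = (\<Sum>k. real k powr (-1 - \<kappa>))"
  let ?w = "2 * sqrt (2 * pi) * A"
  have sZ: "summable (\<lambda>k. real k powr (-1 - \<kappa>))" using \<kappa> by (simp add: summable_real_powr_iff)
  have Z0: "0 \<le> Z" unfolding Z_def by (intro suminf_nonneg sZ) auto
  have c_eq: "c k = sqrt (2 * pi) * real (Suc k) * (a k - 2 * a (Suc k) + a (Suc (Suc k)))" for k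
    by (simp add: c_def algebra_simps)
  have c1: "\<bar>c k\<bar> * real k powr \<delta> \<le> ?w * real k powr (-1 - \<kappa>)" for k
  proof (cases "k = 0")
    case False
    then have k: "real k > 0" "k \<ge> 1" by auto
    have "\<bar>c k\<bar> * real k powr \<delta> = sqrt (2 * pi) * real (Suc k) * \<bar>a k - 2 * a (Suc k) + a (Suc (Suc k))\<bar> * real k powr \<delta>"
      by (simp add: c_eq abs_mult)
    also have "\<dots> \<le> sqrt (2 * pi) * (2 * real k) * (A * real k powr (-2 - (\<delta> + \<kappa>))) * real k powr \<delta>"
      using A(2)[OF k(2)] k A(1) by (intro mult_mono mult_nonneg_nonneg) (auto simp: \<delta>_def)
    also have "\<dots> = ?w * (real k powr 1 * real k powr (-2 - (\<delta> + \<kappa>)) * real k powr \<delta>)"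
      using k by simp
    also have "real k powr 1 * real k powr (-2 - (\<delta> + \<kappa>)) * real k powr \<delta> = real k powr (-1 - \<kappa>)"
      by (simp only: powr_add[symmetric]) (simp add: algebra_simps)
    finally show ?thesis .
  qed simp
  have s1: "summable (\<lambda>k. \<bar>c k\<bar> * real k powr \<delta>)"
    by (rule summable_comparison_test'[OF summable_mult[OF sZ, of ?w], of 0]) (use c1 in auto)
  have s2: "(\<Sum>k. \<bar>c k\<bar> * real k powr \<delta>) \<le> ?w * Z"
    unfolding Z_def suminf_mult[OF sZ, symmetric] by (intro suminf_le c1 s1 summable_mult sZ)
  have s0: "summable (\<lambda>k. \<bar>c k\<bar>)"
  proof (rule summable_comparison_test'[OF s1, of 1])
    fix k :: nat
    assume "1 \<le> k"
    then have "1 \<le> real k powr \<delta>" using \<delta> by (intro ge_one_powr_ge_zero) (auto simp: \<delta>_def)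
    then show "norm \<bar>c k\<bar> \<le> \<bar>c k\<bar> * real k powr \<delta>" by (simp add: mult_le_cancel_left1)
  qed
  have C: "f \<in> Cn_torus (nat \<lfloor>\<gamma>\<rfloor>)" using f by (simp add: holder_space_def)
  have "conv_torus p f x = (\<Sum>k. c k * fejer k f x)" for x
    unfolding c_def
  proof (rule conv_torus_eq_fejer_series[OF p])
    show "(\<lambda>k. real k * (sqrt (2 * pi) * a k)) \<longlonglongrightarrow> 0"
      using tendsto_mult_right_zero[OF a0, of "sqrt (2 * pi)"] by (simp add: mult.left_commute)
    show "continuous_on UNIV f" using Cn_torus_continuous[OF C, of 0 UNIV] by simp
  qed (use a s0 Cn_torus_periodic[OF C] in \<open>auto simp: c_def dest: integral_unique\<close>)
  then have conv: "conv_torus p f = (\<lambda>x. \<Sum>k. c k * fejer k f x)" by auto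
  have "1 \<le> m \<or> integral {-pi..pi} f = 0 \<or> \<bar>c 0\<bar> \<le> ?w * (1 + Z)"
  proof -
    have "\<bar>c 0\<bar> \<le> ?w * (1 + Z)" if "\<bar>a 0 - 2 * a 1 + a 2\<bar> \<le> A"
    proof -
      have "\<bar>c 0\<bar> = sqrt (2 * pi) * \<bar>a 0 - 2 * a 1 + a 2\<bar>"
        by (simp add: c_eq abs_mult numeral_2_eq_2)
      also have "\<dots> \<le> sqrt (2 * pi) * A" by (intro mult_left_mono that) auto
      also have "\<dots> \<le> ?w * (1 + Z)"
        using A(1) Z0 by (simp add: algebra_simps)
      finally show ?thesis .
    qed
    then show ?thesis using A0 by blast
  qed
  moreover have "?w * Z \<le> ?w * (1 + Z)" using A(1) by (intro mult_left_mono) auto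
  then have "(\<Sum>k. \<bar>c k\<bar> * real k powr \<delta>) \<le> ?w * (1 + Z)" using s2 by (rule order_trans[rotated])
  ultimately have "holder_norm_le \<gamma>' (distr_deriv m (distr_of (conv_torus p f)))
    (real (nat \<lfloor>\<gamma>'\<rfloor> + 2) * ((24 * 2 ^ (m + nat \<lfloor>\<gamma>'\<rfloor>) + 1) * (?w * (1 + Z)) * holder_norm \<gamma> f))"
    unfolding conv
    by (intro fejer_series_holder f \<gamma> \<gamma>' \<delta>) (use s1 in \<open>auto simp: \<delta>_def\<close>)
  then show ?thesis
    by (rule holder_norm_le_mono) (simp add: multiplier_const_def Z_def[symmetric] mult.assoc mult.left_commute)
qed

text \<open>The mean value theorem, applied to F (x + 1) - F x and then to F', gives F'' at a point
  between k and k + 2; as q <= 0 that point may be replaced by k. Starting at k = 1 avoids the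
  origin, where x^\<alpha> with \<alpha> < 2 is not twice differentiable.\<close>

lemma second_difference_bound:
  fixes F :: "real \<Rightarrow> real"
  assumes F: "\<And>x. x > 0 \<Longrightarrow> (F has_real_derivative F' x) (at x)"
    "\<And>x. x > 0 \<Longrightarrow> (F' has_real_derivative F'' x) (at x)"
    and A: "\<And>x. x > 0 \<Longrightarrow> \<bar>F'' x\<bar> \<le> A * x powr q" "0 \<le> A" "q \<le> 0" and k: "k \<ge> (1::nat)"
  shows "\<bar>F (real k) - 2 * F (real (Suc k)) + F (real (Suc (Suc k)))\<bar> \<le> A * real k powr q"
proof -
  have dG: "((\<lambda>x. F (x + 1) - F x) has_real_derivative (F' (x + 1) - F' x)) (at x)" if "x > 0" for x
    using F(1)[of "x + 1"] F(1)[of x] that by (intro DERIV_diff) (simp_all add: DERIV_shift)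
  obtain z where z: "real k < z" "z < real k + 1"
    "(F (real k + 1 + 1) - F (real k + 1)) - (F (real k + 1) - F (real k)) = F' (z + 1) - F' z"
    using MVT2[of "real k" "real k + 1" "\<lambda>x. F (x + 1) - F x" "\<lambda>x. F' (x + 1) - F' x"] dG k by fastforce
  obtain w where w: "z < w" "w < z + 1" "F' (z + 1) - F' z = F'' w"
    using MVT2[of z "z + 1" F' F''] F(2) z k by fastforce
  have "F (real k) - 2 * F (real (Suc k)) + F (real (Suc (Suc k))) = F'' w"
    using z(3) w(3) by (simp add: algebra_simps)
  also have "\<bar>F'' w\<bar> \<le> A * w powr q" using w z k by (intro A) auto
  also have "\<dots> \<le> A * real k powr q"
    using w z k A by (intro mult_left_mono powr_mono2') auto
  finally show ?thesis .
qed

text \<open>The factor y^j offsets the extra decay of the j-th derivative, so one rate serves all j.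
  Letting \<rho> range over [0, l] trades decay for a milder singularity at 0; this freedom later
  produces every admissible power of t.\<close>

lemma symbol_decay:
  fixes y :: real
  assumes "\<bar>d\<bar> \<le> C / (1 + y ^ (l + j))" "y > 0" "0 \<le> \<rho>" "\<rho> \<le> real l"
  shows "\<bar>y ^ j * d\<bar> \<le> C * y powr (- \<rho>)"
proof -
  have pos: "0 < 1 + y ^ (l + j)" using assms(2) by (simp add: add_pos_nonneg)
  have C0: "0 \<le> C"
    using order_trans[OF abs_ge_zero assms(1)] pos by (simp add: zero_le_divide_iff)
  have "y ^ j * y powr \<rho> \<le> 1 + y ^ (l + j)"
  proof (cases "y \<le> 1")
    case True
    then have "y ^ j * y powr \<rho> \<le> 1 * 1"
      using assms by (intro mult_mono power_le_one powr_le1) auto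
    then show ?thesis using zero_le_power[of y "l + j"] assms(2) by linarith
  next
    case False
    then have "y powr \<rho> \<le> y powr real l" using assms by (intro powr_mono) auto
    then have "y ^ j * y powr \<rho> \<le> y ^ j * y ^ l"
      using assms by (intro mult_left_mono) (auto simp: powr_realpow)
    then show ?thesis by (simp add: power_add mult.commute)
  qed
  then have "C * (y ^ j * y powr \<rho>) \<le> C * (1 + y ^ (l + j))" using C0 by (rule mult_left_mono)
  then have "C * y ^ j / (1 + y ^ (l + j)) \<le> C * y powr (- \<rho>)"
    using pos assms(2) by (simp add: powr_minus field_simps)
  moreover have "\<bar>y ^ j * d\<bar> \<le> y ^ j * (C / (1 + y ^ (l + j)))"
    using mult_left_mono[OF assms(1), of "y ^ j"] assms(2) by (simp add: abs_mult)
  ultimately show ?thesis by (simp add: mult.commute)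
qed

text \<open>The 2 in the minimum is the triangle inequality. The other bound is the mean value
  theorem for the scale-invariant derivative y Q' y, which makes the result depend on the ratio y' /
  y only.\<close>

lemma symbol_difference:
  fixes Q :: "real \<Rightarrow> real"
  assumes Q: "\<And>y. y > 0 \<Longrightarrow> (Q has_real_derivative Q' y) (at y)"
    and C: "\<And>y. y > 0 \<Longrightarrow> \<bar>Q y\<bar> \<le> C * y powr (- \<rho>)" "\<And>y. y > 0 \<Longrightarrow> \<bar>y * Q' y\<bar> \<le> C * y powr (- \<rho>)"
    and C0: "0 \<le> C" and \<rho>: "0 \<le> \<rho>" and y: "0 < y" "y < y'"
  shows "\<bar>Q y' - Q y\<bar> \<le> C * y powr (- \<rho>) * min 2 (y' / y - 1)"
proof -
  have m: "C * z powr (- \<rho>) \<le> C * y powr (- \<rho>)" if "y \<le> z" for z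
    using that y \<rho> C0 by (intro mult_left_mono powr_mono2') auto
  have "\<bar>Q y' - Q y\<bar> \<le> C * y powr (- \<rho>) * 2"
    using C(1)[of y] C(1)[of y'] m[of y'] y by linarith
  moreover have "\<bar>Q y' - Q y\<bar> \<le> C * y powr (- \<rho>) * (y' / y - 1)"
  proof -
    obtain z where z: "y < z" "z < y'" "Q y' - Q y = (y' - y) * Q' z"
      using MVT2[of y y' Q Q'] Q y by fastforce
    have "\<bar>Q y' - Q y\<bar> = (y' - y) / z * \<bar>z * Q' z\<bar>"
      using z y by (simp add: abs_mult)
    also have "\<dots> \<le> (y' - y) / y * (C * y powr (- \<rho>))"
      using z y C(2)[of z] m[of z]
      by (intro mult_mono divide_left_mono) auto
    also have "\<dots> = C * y powr (- \<rho>) * (y' / y - 1)"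
      using y by (simp add: field_simps)
    finally show ?thesis .
  qed
  ultimately show ?thesis by (simp add: min_def)
qed

text \<open>With x = (t' - t) / t: for x >= 1 the cap 2 is enough, and for x < 1 the mean value
  theorem gives a bound linear in x, which is at most x^\<epsilon> precisely because \<epsilon> <=
  1.\<close>

lemma time_ratio_bound:
  fixes t t' \<beta> \<epsilon> :: real
  assumes t: "0 < t" "t < t'" and \<beta>: "0 < \<beta>" and \<epsilon>: "0 \<le> \<epsilon>" "\<epsilon> \<le> 1"
  shows "min 2 ((t' / t) powr \<beta> - 1) \<le> (2 + \<beta> * (1 + 2 powr \<beta>)) * ((t' - t) / t) powr \<epsilon>"
proof -
  define x where "x = (t' - t) / t"
  have x: "x > 0" "t' / t = 1 + x" using t by (auto simp: x_def field_simps)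
  let ?K = "2 + \<beta> * (1 + 2 powr \<beta>)"
  have K: "?K \<ge> 2" using \<beta> by simp
  have "min 2 ((1 + x) powr \<beta> - 1) \<le> ?K * x powr \<epsilon>"
  proof (cases "x \<ge> 1")
    case True
    then have "1 \<le> x powr \<epsilon>" using \<epsilon> by (intro ge_one_powr_ge_zero)
    then have "2 * 1 \<le> ?K * x powr \<epsilon>" using K by (intro mult_mono) auto
    then show ?thesis by simp
  next
    case False
    obtain z where z: "1 < z" "z < 1 + x" "(1 + x) powr \<beta> - 1 powr \<beta> = (1 + x - 1) * (\<beta> * z powr (\<beta> - 1))"
    proof -
      have "((\<lambda>z. z powr \<beta>) has_real_derivative \<beta> * z powr (\<beta> - 1)) (at z)" if "1 \<le> z" for z
        using that by (intro has_real_derivative_powr) simp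
      from MVT2[OF _ this, of 1 "1 + x"] x that show thesis by auto
    qed
    have "z powr (\<beta> - 1) \<le> z powr \<beta>" using z by (intro powr_mono) auto
    also have "\<dots> \<le> 2 powr \<beta>" using z False \<beta> by (intro powr_mono2) auto
    finally have "(1 + x) powr \<beta> - 1 \<le> x * (\<beta> * 2 powr \<beta>)"
      using z(3) x \<beta> by (simp add: mult_left_mono)
    also have "\<dots> \<le> ?K * x"
      using x \<beta> by (simp add: algebra_simps)
    also have "\<dots> \<le> ?K * x powr \<epsilon>"
      using powr_mono'[of \<epsilon> 1 x] False x \<epsilon> K by (intro mult_left_mono) auto
    finally show ?thesis by simp
  qed
  then show ?thesis using x(2) by (simp add: x_def)
qed

text \<open>With y = \<tau> x^\<alpha> the operator x d/dx acts as \<alpha> y d/dy, so derivatives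
  in x are powers of 1/x times functions of y alone, and \<tau> enters only through y. This gives
  bounds uniform in time. The statement hides the derivatives of \<phi> and fixes one constant for
  all estimates.\<close>

lemma phi_symbol:
  fixes \<phi> :: "real \<Rightarrow> real" and \<alpha> :: real
  assumes \<phi>: "phi_assumption \<phi> l"
  obtains \<Psi> \<Phi> :: "real \<Rightarrow> real" and C :: real where "C > 0"
    and "\<And>\<tau> x. \<tau> > 0 \<Longrightarrow> x > 0 \<Longrightarrow>
      ((\<lambda>x. \<phi> (\<tau> * x powr \<alpha>)) has_real_derivative \<Phi> (\<tau> * x powr \<alpha>) / x) (at x)"
    and "\<And>\<tau> x. \<tau> > 0 \<Longrightarrow> x > 0 \<Longrightarrow>
      ((\<lambda>x. \<Phi> (\<tau> * x powr \<alpha>) / x) has_real_derivative x powr (-2) * \<Psi> (\<tau> * x powr \<alpha>)) (at x)"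
    and "\<And>y \<rho>. y > 0 \<Longrightarrow> 0 \<le> \<rho> \<Longrightarrow> \<rho> \<le> real l \<Longrightarrow> \<bar>\<Psi> y\<bar> \<le> C * y powr (- \<rho>)"
    and "\<And>y \<rho>. y > 0 \<Longrightarrow> 0 \<le> \<rho> \<Longrightarrow> \<rho> \<le> real l \<Longrightarrow> \<bar>\<phi> y\<bar> \<le> C * y powr (- \<rho>)"
    and "\<And>y y' \<rho>. 0 < y \<Longrightarrow> y < y' \<Longrightarrow> 0 \<le> \<rho> \<Longrightarrow> \<rho> \<le> real l \<Longrightarrow>
      \<bar>\<Psi> y' - \<Psi> y\<bar> \<le> C * y powr (- \<rho>) * min 2 (y' / y - 1)"
    and "\<And>y y' \<rho>. 0 < y \<Longrightarrow> y < y' \<Longrightarrow> 0 \<le> \<rho> \<Longrightarrow> \<rho> \<le> real l \<Longrightarrow>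
      \<bar>\<phi> y' - \<phi> y\<bar> \<le> C * y powr (- \<rho>) * min 2 (y' / y - 1)"
proof -
  obtain D where D0: "\<And>x. x \<ge> 0 \<Longrightarrow> D 0 x = \<phi> x"
    and D: "\<And>j x. x \<ge> 0 \<Longrightarrow> (D j has_real_derivative D (Suc j) x) (at x within {0..})"
    and DC: "\<And>j. \<exists>C. \<forall>x\<ge>0. \<bar>D j x\<bar> \<le> C / (1 + x ^ (l + j))"
    using \<phi> unfolding phi_assumption_def by metis
  obtain c where c: "\<And>j x. x \<ge> 0 \<Longrightarrow> \<bar>D j x\<bar> \<le> c j / (1 + x ^ (l + j))"
    using DC by metis
  have dec: "\<bar>y ^ j * D j y\<bar> \<le> c j * y powr (- \<rho>)" if "y > 0" "0 \<le> \<rho>" "\<rho> \<le> real l" for j y \<rho>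
    by (rule symbol_decay[OF c that]) (use that in simp)
  have c0: "c j \<ge> 0" for j
  proof -
    have "0 \<le> c j * 1 powr (- 0)"
      using order_trans[OF abs_ge_zero dec[of 1 0 j]] by simp
    then show ?thesis by simp
  qed
  have DD: "(D j has_real_derivative D (Suc j) y) (at y)" if "y > 0" for j y
  proof -
    have "(D j has_real_derivative D (Suc j) y) (at y within {0<..})"
      by (rule DERIV_subset[OF D]) (use that in auto)
    then show ?thesis using that at_within_open[of y "{0<..}"] by simp
  qed
  have d\<phi>: "(\<phi> has_real_derivative D 1 y) (at y)" if "y > 0" for y
    by (rule has_field_derivative_transform_within_open[of "D 0" _ _ "{0<..}"])
      (use DD[of y 0] D0 that in auto)
  define \<Phi> where "\<Phi> y = \<alpha> * (y * D 1 y)" for y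
  define \<Psi> where "\<Psi> y = (\<alpha>\<^sup>2 - \<alpha>) * (y * D 1 y) + \<alpha>\<^sup>2 * (y\<^sup>2 * D 2 y)" for y
  define \<Psi>' where "\<Psi>' y = (\<alpha>\<^sup>2 - \<alpha>) * (D 1 y + y * D 2 y) + \<alpha>\<^sup>2 * (2 * y * D 2 y + y\<^sup>2 * D 3 y)" for y
  \<comment> \<open>The third derivative of \<phi> enters through y \<Psi>'(y), which controls the
    differences of \<Psi>; the 1 makes the constant positive.\<close>
  define C where "C = 1 + c 0 + c 1 + (\<bar>\<alpha>\<^sup>2 - \<alpha>\<bar> * (c 1 + c 2) + \<alpha>\<^sup>2 * (2 * c 2 + c 3))"
  have dy: "((\<lambda>x. \<tau> * x powr \<alpha>) has_real_derivative \<alpha> * (\<tau> * x powr \<alpha>) / x) (at x)" if "x > 0" for \<tau> x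
    using DERIV_cmult[OF has_real_derivative_powr[OF that, of \<alpha>], of \<tau>] that
    by (simp add: powr_diff mult.left_commute)
  have d\<Psi>: "(\<Psi> has_real_derivative \<Psi>' y) (at y)" if "y > 0" for y
  proof -
    have "(D 1 has_real_derivative D 2 y) (at y)" "(D 2 has_real_derivative D 3 y) (at y)"
      using DD[OF that, of 1] DD[OF that, of 2] by (simp_all add: eval_nat_numeral)
    then show ?thesis
      unfolding \<Psi>_def[abs_def] \<Psi>'_def
      by (auto intro!: derivative_eq_intros simp: algebra_simps)
  qed
  have decs: "\<bar>y * D 1 y\<bar> \<le> c 1 * y powr (- \<rho>)" "\<bar>y\<^sup>2 * D 2 y\<bar> \<le> c 2 * y powr (- \<rho>)"
    "\<bar>y ^ 3 * D 3 y\<bar> \<le> c 3 * y powr (- \<rho>)" "\<bar>\<phi> y\<bar> \<le> c 0 * y powr (- \<rho>)"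
    if "y > 0" "0 \<le> \<rho>" "\<rho> \<le> real l" for y \<rho>
    using dec[OF that, of 1] dec[OF that, of 2] dec[OF that, of 3] dec[OF that, of 0] D0[of y] that by auto
  have comb: "\<bar>(\<alpha>\<^sup>2 - \<alpha>) * u + \<alpha>\<^sup>2 * v\<bar> \<le> (\<bar>\<alpha>\<^sup>2 - \<alpha>\<bar> * U + \<alpha>\<^sup>2 * V) * w"
    if "\<bar>u\<bar> \<le> U * w" "\<bar>v\<bar> \<le> V * w" for u v U V w
  proof -
    have "\<bar>(\<alpha>\<^sup>2 - \<alpha>) * u + \<alpha>\<^sup>2 * v\<bar> \<le> \<bar>\<alpha>\<^sup>2 - \<alpha>\<bar> * \<bar>u\<bar> + \<alpha>\<^sup>2 * \<bar>v\<bar>"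
      using abs_triangle_ineq[of "(\<alpha>\<^sup>2 - \<alpha>) * u" "\<alpha>\<^sup>2 * v"] by (simp add: abs_mult)
    also have "\<dots> \<le> \<bar>\<alpha>\<^sup>2 - \<alpha>\<bar> * (U * w) + \<alpha>\<^sup>2 * (V * w)"
      by (intro add_mono mult_left_mono that) auto
    finally show ?thesis by (simp add: algebra_simps)
  qed
  have C_ge: "\<bar>\<alpha>\<^sup>2 - \<alpha>\<bar> * c 1 + \<alpha>\<^sup>2 * c 2 \<le> C" "\<bar>\<alpha>\<^sup>2 - \<alpha>\<bar> * (c 1 + c 2) + \<alpha>\<^sup>2 * (2 * c 2 + c 3) \<le> C"
    "c 0 \<le> C" "c 1 \<le> C" "0 < C"
  proof -
    have *: "\<bar>\<alpha>\<^sup>2 - \<alpha>\<bar> * c 1 \<le> \<bar>\<alpha>\<^sup>2 - \<alpha>\<bar> * (c 1 + c 2)" "\<alpha>\<^sup>2 * c 2 \<le> \<alpha>\<^sup>2 * (2 * c 2 + c 3)"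
      "0 \<le> \<bar>\<alpha>\<^sup>2 - \<alpha>\<bar> * c 1" "0 \<le> \<alpha>\<^sup>2 * c 2"
      using c0 by (auto intro!: mult_left_mono)
    then show "\<bar>\<alpha>\<^sup>2 - \<alpha>\<bar> * c 1 + \<alpha>\<^sup>2 * c 2 \<le> C" "\<bar>\<alpha>\<^sup>2 - \<alpha>\<bar> * (c 1 + c 2) + \<alpha>\<^sup>2 * (2 * c 2 + c 3) \<le> C"
      "c 0 \<le> C" "c 1 \<le> C" "0 < C"
      using c0[of 0] c0[of 1] unfolding C_def by linarith+
  qed
  have Cw: "u \<le> C * y powr (- \<rho>)" if "u \<le> K * y powr (- \<rho>)" "K \<le> C" for u K y \<rho> :: real
    using that(1) mult_right_mono[OF that(2), of "y powr (- \<rho>)"] by simp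
  have b\<Psi>: "\<bar>\<Psi> y\<bar> \<le> C * y powr (- \<rho>)" if "y > 0" "0 \<le> \<rho>" "\<rho> \<le> real l" for y \<rho>
    unfolding \<Psi>_def by (rule Cw[OF comb[OF decs(1,2)[OF that]] C_ge(1)])
  have b\<phi>: "\<bar>\<phi> y\<bar> \<le> C * y powr (- \<rho>)" if "y > 0" "0 \<le> \<rho>" "\<rho> \<le> real l" for y \<rho>
    by (rule Cw[OF decs(4)[OF that] C_ge(3)])
  have b\<Psi>': "\<bar>y * \<Psi>' y\<bar> \<le> C * y powr (- \<rho>)" if y: "y > 0" "0 \<le> \<rho>" "\<rho> \<le> real l" for y \<rho>
  proof -
    have "y * \<Psi>' y = (\<alpha>\<^sup>2 - \<alpha>) * (y * D 1 y + y\<^sup>2 * D 2 y) + \<alpha>\<^sup>2 * (2 * (y\<^sup>2 * D 2 y) + y ^ 3 * D 3 y)"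
      by (simp add: \<Psi>'_def algebra_simps power2_eq_square power3_eq_cube)
    moreover have "\<bar>y * D 1 y + y\<^sup>2 * D 2 y\<bar> \<le> (c 1 + c 2) * y powr (- \<rho>)"
      "\<bar>2 * (y\<^sup>2 * D 2 y) + y ^ 3 * D 3 y\<bar> \<le> (2 * c 2 + c 3) * y powr (- \<rho>)"
      using decs(1,2,3)[OF y] by (auto simp: distrib_right)
    ultimately show ?thesis using Cw[OF comb C_ge(2)] by metis
  qed
  show thesis
  proof (rule that[of C \<Phi> \<Psi>])
    show "C > 0" by (rule C_ge(5))
    show "((\<lambda>x. \<phi> (\<tau> * x powr \<alpha>)) has_real_derivative \<Phi> (\<tau> * x powr \<alpha>) / x) (at x)"
      if "\<tau> > 0" "x > 0" for \<tau> x
    proof -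
      have "((\<lambda>x. \<phi> (\<tau> * x powr \<alpha>)) has_real_derivative D 1 (\<tau> * x powr \<alpha>) * (\<alpha> * (\<tau> * x powr \<alpha>) / x)) (at x)"
        by (rule DERIV_chain2[OF d\<phi> dy]) (use that in auto)
      then show ?thesis by (simp add: \<Phi>_def mult.assoc mult.left_commute mult.commute)
    qed
    show "((\<lambda>x. \<Phi> (\<tau> * x powr \<alpha>) / x) has_real_derivative x powr (-2) * \<Psi> (\<tau> * x powr \<alpha>)) (at x)"
      if "\<tau> > 0" "x > 0" for \<tau> x
    proof -
      let ?y = "\<tau> * x powr \<alpha>"
      have y: "?y > 0" using that by simp
      have "(\<Phi> has_real_derivative \<alpha> * (D 1 ?y + ?y * D 2 ?y)) (at ?y)"
      proof -
        have "(D 1 has_real_derivative D 2 ?y) (at ?y)"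
          using DD[OF y, of 1] by (simp add: eval_nat_numeral)
        then show ?thesis
          unfolding \<Phi>_def[abs_def] by (auto intro!: derivative_eq_intros)
      qed
      from DERIV_chain2[OF this dy[OF that(2)]]
      have "((\<lambda>x. \<Phi> (\<tau> * x powr \<alpha>) / x) has_real_derivative
          ((\<alpha> * (D 1 ?y + ?y * D 2 ?y) * (\<alpha> * ?y / x)) * x - \<Phi> ?y * 1) / (x * x)) (at x)"
        using that by (intro DERIV_divide DERIV_ident) auto
      moreover have "((\<alpha> * (D 1 ?y + ?y * D 2 ?y) * (\<alpha> * ?y / x)) * x - \<Phi> ?y * 1) / (x * x) = x powr (-2) * \<Psi> ?y"
      proof -
        have "x powr (-2) = 1 / (x * x)"
          using that powr_minus_divide[of x 2] by (simp add: power2_eq_square)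
        moreover have "(\<alpha> * (D 1 ?y + ?y * D 2 ?y) * (\<alpha> * ?y / x)) * x - \<Phi> ?y * 1 = \<Psi> ?y"
          using that by (simp add: \<Phi>_def \<Psi>_def power2_eq_square) (simp add: algebra_simps)
        ultimately show ?thesis by simp
      qed
      ultimately show ?thesis by simp
    qed
    show "\<bar>\<Psi> y' - \<Psi> y\<bar> \<le> C * y powr (- \<rho>) * min 2 (y' / y - 1)"
      if "0 < y" "y < y'" "0 \<le> \<rho>" "\<rho> \<le> real l" for y y' \<rho>
      by (rule symbol_difference[of \<Psi> \<Psi>']) (use that d\<Psi> b\<Psi> b\<Psi>' C_ge in auto)
    show "\<bar>\<phi> y' - \<phi> y\<bar> \<le> C * y powr (- \<rho>) * min 2 (y' / y - 1)"
      if "0 < y" "y < y'" "0 \<le> \<rho>" "\<rho> \<le> real l" for y y' \<rho>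
      by (rule symbol_difference[of \<phi> "D 1"]) (use that d\<phi> b\<phi> Cw[OF decs(1) C_ge(4)] C_ge in auto)
  qed (use b\<Psi> b\<phi> in auto)
qed

lemma powr_scaling:
  fixes \<tau> x \<alpha> s :: real
  assumes "\<tau> > 0" "x > 0" "\<alpha> > 0"
  shows "(\<tau> * x powr \<alpha>) powr (- (s / \<alpha>)) = \<tau> powr (- (s / \<alpha>)) * x powr (- s)"
  using assms by (simp add: powr_mult powr_powr)

text \<open>Decay of order one gives k a_k = O(k^(1 - \<alpha>)); \<alpha> > 1 is what removes the
  boundary terms of the summation by parts.\<close>

lemma symbol_sequence_tendsto_0:
  fixes \<phi> :: "real \<Rightarrow> real"
  assumes \<phi>: "\<And>y. y > 0 \<Longrightarrow> \<bar>\<phi> y\<bar> \<le> C * y powr (- 1)" and \<tau>: "\<tau> > 0" and \<alpha>: "\<alpha> > 1"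
  shows "(\<lambda>k. real k * \<phi> (\<tau> * real k powr \<alpha>)) \<longlonglongrightarrow> 0"
proof (rule Lim_null_comparison)
  have "(\<lambda>k. real k powr (1 - \<alpha>)) \<longlonglongrightarrow> 0"
    using \<alpha> by (intro tendsto_neg_powr filterlim_real_sequentially) auto
  then show "(\<lambda>k. C / \<tau> * real k powr (1 - \<alpha>)) \<longlonglongrightarrow> 0"
    by (rule tendsto_mult_right_zero)
  show "\<forall>\<^sub>F k in sequentially. norm (real k * \<phi> (\<tau> * real k powr \<alpha>)) \<le> C / \<tau> * real k powr (1 - \<alpha>)"
  proof (rule eventually_sequentiallyI[of 1])
    fix k :: nat
    assume "1 \<le> k"
    then have k: "real k > 0" by simp
    have "norm (real k * \<phi> (\<tau> * real k powr \<alpha>)) \<le> real k * (C * (\<tau> * real k powr \<alpha>) powr (- 1))"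
      using mult_left_mono[OF \<phi>[of "\<tau> * real k powr \<alpha>"], of "real k"] \<tau> k by (simp add: abs_mult)
    also have "\<dots> = C / \<tau> * real k powr (1 - \<alpha>)"
      using k \<tau> by (simp add: powr_minus_divide powr_diff field_simps)
    finally show "norm (real k * \<phi> (\<tau> * real k powr \<alpha>)) \<le> C / \<tau> * real k powr (1 - \<alpha>)" .
  qed
qed

section \<open>Space and time estimates for convolution with P\<close>

theorem lemma4p6:
  fixes P :: "real \<Rightarrow> real \<Rightarrow> real"
    and \<phi> :: "real \<Rightarrow> real"
    and \<alpha> \<beta> \<gamma> \<kappa> :: real
    and l m :: nat
  assumes "\<alpha> > 1" and "\<beta> > 1 / 2"
    and "l \<ge> 1" and "phi_assumption \<phi> l"
    and "\<And>t. t > 0 \<Longrightarrow> P t \<in> L1_torus"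
    and "\<And>t k. t > 0 \<Longrightarrow>
           fourier_torus (P t) k = complex_of_real (\<phi> (t powr \<beta> * \<bar>real_of_int k\<bar> powr \<alpha>))"
    and "\<gamma> \<ge> 0"
    and "real m < \<gamma> + \<alpha> * real l"
    and "\<kappa> > 0"
  shows
    "(\<forall>T>0. \<exists>C>0. \<forall>\<gamma>'. \<gamma>' > 0 \<and> \<gamma>' \<notin> \<nat> \<and>
        0 \<le> \<gamma>' - \<gamma> + real m \<and> \<gamma>' - \<gamma> + real m < \<alpha> * real l \<and>
        \<kappa> \<le> \<gamma> - \<gamma>' + \<alpha> * real l - real m \<longrightarrow>
        (\<forall>f \<in> holder_space \<gamma>. \<forall>t>0.
           (m = 0 \<and> integral {-pi..pi} f \<noteq> 0 \<longrightarrow> t \<le> T) \<longrightarrow>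
           holder_norm_le \<gamma>' (distr_deriv m (distr_of (conv_torus (P t) f)))
             (C * t powr (- (\<beta> / \<alpha>) * (\<gamma>' - \<gamma> + real m + \<kappa>)) * holder_norm \<gamma> f)))
     \<and>
     (\<exists>C>0. \<forall>\<gamma>'. \<gamma>' > 0 \<and> \<gamma>' \<notin> \<nat> \<and>
        0 \<le> \<gamma>' - \<gamma> + real m \<and> \<gamma>' - \<gamma> + real m < \<alpha> * real l \<and>
        \<kappa> \<le> \<gamma> - \<gamma>' + \<alpha> * real l - real m \<longrightarrow>
        (\<forall>\<epsilon>. 0 \<le> \<epsilon> \<and> \<epsilon> \<le> \<beta> \<and> \<epsilon> \<le> 1 \<longrightarrow>
        (\<forall>f \<in> holder_space \<gamma>. \<forall>t>0. \<forall>t'>t.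
           holder_norm_le \<gamma>' (distr_deriv m (distr_of (conv_torus (\<lambda>x. P t' x - P t x) f)))
             (C * (t' - t) powr \<epsilon> *
                t powr (- (\<beta> / \<alpha>) * (\<gamma>' - \<gamma> + real m + \<kappa>) - \<epsilon>) * holder_norm \<gamma> f))))"
proof -
  note L1 = assms(5) and F = assms(6)
  have \<alpha>: "\<alpha> > 0" and \<beta>: "\<beta> > 0" using assms(1,2) by auto
  obtain \<Psi> \<Phi> :: "real \<Rightarrow> real" and C :: real where C: "C > 0"
    and d1: "\<And>\<tau> x. \<tau> > 0 \<Longrightarrow> x > 0 \<Longrightarrow>
      ((\<lambda>x. \<phi> (\<tau> * x powr \<alpha>)) has_real_derivative \<Phi> (\<tau> * x powr \<alpha>) / x) (at x)"
    and d2: "\<And>\<tau> x. \<tau> > 0 \<Longrightarrow> x > 0 \<Longrightarrow>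
      ((\<lambda>x. \<Phi> (\<tau> * x powr \<alpha>) / x) has_real_derivative x powr (-2) * \<Psi> (\<tau> * x powr \<alpha>)) (at x)"
    and b\<Psi>: "\<And>y \<rho>. y > 0 \<Longrightarrow> 0 \<le> \<rho> \<Longrightarrow> \<rho> \<le> real l \<Longrightarrow> \<bar>\<Psi> y\<bar> \<le> C * y powr (- \<rho>)"
    and b\<phi>: "\<And>y \<rho>. y > 0 \<Longrightarrow> 0 \<le> \<rho> \<Longrightarrow> \<rho> \<le> real l \<Longrightarrow> \<bar>\<phi> y\<bar> \<le> C * y powr (- \<rho>)"
    and diff\<Psi>: "\<And>y y' \<rho>. 0 < y \<Longrightarrow> y < y' \<Longrightarrow> 0 \<le> \<rho> \<Longrightarrow> \<rho> \<le> real l \<Longrightarrow>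
      \<bar>\<Psi> y' - \<Psi> y\<bar> \<le> C * y powr (- \<rho>) * min 2 (y' / y - 1)"
    and diff\<phi>: "\<And>y y' \<rho>. 0 < y \<Longrightarrow> y < y' \<Longrightarrow> 0 \<le> \<rho> \<Longrightarrow> \<rho> \<le> real l \<Longrightarrow>
      \<bar>\<phi> y' - \<phi> y\<bar> \<le> C * y powr (- \<rho>) * min 2 (y' / y - 1)"
    by (rule phi_symbol[OF assms(4), of \<alpha>]) (rule that; assumption)
  \<comment> \<open>Since \<open>0 powr \<alpha> = 0\<close>, the entry \<open>a t 0\<close> is
    \<open>\<phi> 0\<close> for every t.\<close>
  define a where "a t k = \<phi> (t powr \<beta> * real k powr \<alpha>)" for t :: real and k :: nat
  have coeffs: "((\<lambda>u. P t u * cos (real j * u)) has_integral sqrt (2 * pi) * a t j) {-pi..pi}"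
    "((\<lambda>u. P t u * sin (real j * u)) has_integral 0) {-pi..pi}" if "t > 0" for t j
    using fourier_torus_real_coeffs[OF L1[OF that], of j "a t j"] F[OF that, of "int j"]
    by (simp_all add: a_def)
  have lim: "(\<lambda>k. real k * a t k) \<longlonglongrightarrow> 0" if "t > 0" for t
    unfolding a_def using that assms(3) b\<phi>[of _ 1]
    by (intro symbol_sequence_tendsto_0[of \<phi> C] assms(1)) auto
  \<comment> \<open>Decay of order \<rho> = s / \<alpha> in the scaled variable splits into the time
    rate of the theorem and the factor x^(-s) that pays for the growth of the Fejer means.\<close>
  have scale: "(t powr \<beta> * x powr \<alpha>) powr (- (s / \<alpha>)) = t powr (- (\<beta> / \<alpha>) * s) * x powr (- s)"
    if "t > 0" "x > 0" for t x s
    using powr_scaling[of "t powr \<beta>" x \<alpha> s] that \<alpha> by (simp add: powr_powr)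
  \<comment> \<open>The upper bound on \<kappa> forces \<gamma>' <= \<gamma> + \<alpha> l, so
    \<open>b\<close> dominates the integer part of every admissible \<gamma>'.\<close>
  define b where "b = nat \<lfloor>\<gamma> + \<alpha> * real l\<rfloor>"
  define K where "K = multiplier_const \<kappa> m b"
  have K: "K > 0" unfolding K_def by (rule multiplier_const_pos[OF assms(9)])
  have estimate: "holder_norm_le \<gamma>' (distr_deriv m (distr_of (conv_torus p f))) (K * A * holder_norm \<gamma> f)"
    if "p \<in> L1_torus"
      "\<And>j. ((\<lambda>u. p u * cos (real j * u)) has_integral sqrt (2 * pi) * r j) {-pi..pi}"
      "\<And>j. ((\<lambda>u. p u * sin (real j * u)) has_integral 0) {-pi..pi}"
      "(\<lambda>k. real k * r k) \<longlonglongrightarrow> 0" and A: "0 \<le> A"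
      "\<And>k. k \<ge> 1 \<Longrightarrow> \<bar>r k - 2 * r (Suc k) + r (Suc (Suc k))\<bar> \<le>
        A * real k powr (-2 - (\<gamma>' - \<gamma> + real m + \<kappa>))"
      and f: "f \<in> holder_space \<gamma>" and \<gamma>': "\<gamma>' > 0" "\<gamma>' \<notin> \<nat>" "0 \<le> \<gamma>' - \<gamma> + real m"
        "\<kappa> \<le> \<gamma> - \<gamma>' + \<alpha> * real l - real m"
      and "1 \<le> m \<or> integral {-pi..pi} f = 0 \<or> \<bar>r 0 - 2 * r 1 + r 2\<bar> \<le> A"
    for p r A f \<gamma>'
  proof -
    have "nat \<lfloor>\<gamma>'\<rfloor> \<le> b"
      unfolding b_def using \<gamma>' assms(9) by (intro nat_mono floor_mono) simp
    then have "multiplier_const \<kappa> m (nat \<lfloor>\<gamma>'\<rfloor>) * A * holder_norm \<gamma> f \<le> K * A * holder_norm \<gamma> f"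
      unfolding K_def using A(1) holder_space_bounds(3)[OF f assms(7)]
      by (intro mult_right_mono multiplier_const_mono assms(9)) auto
    moreover have "holder_norm_le \<gamma>' (distr_deriv m (distr_of (conv_torus p f)))
        (multiplier_const \<kappa> m (nat \<lfloor>\<gamma>'\<rfloor>) * A * holder_norm \<gamma> f)"
      using that by (intro holder_multiplier_estimate[where a = r] assms(7,9))
    ultimately show ?thesis by (rule holder_norm_le_mono[rotated])
  qed
  show ?thesis
  proof (intro conjI allI impI)
    fix T :: real
    assume T: "T > 0"
    \<comment> \<open>\<open>C\<close> handles k >= 1. At k = 0 the second difference is at most 4
      \<phi>(0), and for t <= T the rate is at least max(1, T)^(-\<beta> l), because s / \<alpha> <=
      l.\<close>
    define E where "E = C + 4 * \<phi> 0 * max 1 T powr (\<beta> * real l)"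
    have pos: "0 < \<phi> y" "\<phi> y \<le> \<phi> 0" if "y \<ge> 0" for y
      using assms(4) that unfolding phi_assumption_def by (metis order_le_less order_refl)+
    have E: "E > 0" "C \<le> E" using C pos[of 0] by (auto simp: E_def add_pos_nonneg)
    show "\<exists>C>0. \<forall>\<gamma>'. \<gamma>' > 0 \<and> \<gamma>' \<notin> \<nat> \<and>
        0 \<le> \<gamma>' - \<gamma> + real m \<and> \<gamma>' - \<gamma> + real m < \<alpha> * real l \<and>
        \<kappa> \<le> \<gamma> - \<gamma>' + \<alpha> * real l - real m \<longrightarrow>
        (\<forall>f \<in> holder_space \<gamma>. \<forall>t>0.
           (m = 0 \<and> integral {-pi..pi} f \<noteq> 0 \<longrightarrow> t \<le> T) \<longrightarrow>
           holder_norm_le \<gamma>' (distr_deriv m (distr_of (conv_torus (P t) f)))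
             (C * t powr (- (\<beta> / \<alpha>) * (\<gamma>' - \<gamma> + real m + \<kappa>)) * holder_norm \<gamma> f))"
    proof (intro exI[of _ "K * E"] conjI allI impI ballI)
      show "K * E > 0" using K E by simp
      fix \<gamma>' t :: real and f
      assume \<gamma>': "\<gamma>' > 0 \<and> \<gamma>' \<notin> \<nat> \<and> 0 \<le> \<gamma>' - \<gamma> + real m \<and> \<gamma>' - \<gamma> + real m < \<alpha> * real l \<and>
          \<kappa> \<le> \<gamma> - \<gamma>' + \<alpha> * real l - real m"
        and f: "f \<in> holder_space \<gamma>" and t: "0 < t"
        and tT: "m = 0 \<and> integral {-pi..pi} f \<noteq> 0 \<longrightarrow> t \<le> T"
      define s where "s = \<gamma>' - \<gamma> + real m + \<kappa>"
      \<comment> \<open>The upper bound on \<kappa> is exactly s <= \<alpha> l, which makes s /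
        \<alpha> an admissible decay order.\<close>
      have s: "0 < s" "s \<le> \<alpha> * real l" "0 \<le> s / \<alpha>" "s / \<alpha> \<le> real l"
        using \<gamma>' assms(9) \<alpha> by (auto simp: s_def divide_le_eq mult.commute)
      have \<tau>: "t powr \<beta> > 0" using t by simp
      let ?X = "t powr (- (\<beta> / \<alpha>) * s)"
      have "holder_norm_le \<gamma>' (distr_deriv m (distr_of (conv_torus (P t) f))) (K * (E * ?X) * holder_norm \<gamma> f)"
      proof (rule estimate[where r = "a t"])
        show "\<bar>a t k - 2 * a t (Suc k) + a t (Suc (Suc k))\<bar> \<le>
            E * ?X * real k powr (-2 - (\<gamma>' - \<gamma> + real m + \<kappa>))" if "k \<ge> 1" for k
        proof -
          have "\<bar>a t k - 2 * a t (Suc k) + a t (Suc (Suc k))\<bar> \<le> C * ?X * real k powr (-2 - s)"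
            unfolding a_def
          proof (rule second_difference_bound[OF d1[OF \<tau>] d2[OF \<tau>] _ _ _ that])
            show "\<bar>x powr (-2) * \<Psi> (t powr \<beta> * x powr \<alpha>)\<bar> \<le> C * ?X * x powr (-2 - s)" if x: "x > 0" for x
            proof -
              have "\<bar>\<Psi> (t powr \<beta> * x powr \<alpha>)\<bar> \<le> C * (?X * x powr (- s))"
                using b\<Psi>[of "t powr \<beta> * x powr \<alpha>" "s / \<alpha>"] x t s by (simp add: scale)
              from mult_left_mono[OF this, of "x powr (-2)"]
              have "\<bar>x powr (-2) * \<Psi> (t powr \<beta> * x powr \<alpha>)\<bar> \<le> C * ?X * (x powr (-2) * x powr (- s))"
                by (simp add: abs_mult mult.left_commute mult.assoc)
              then show ?thesis by (simp flip: powr_add)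
            qed
          qed (use C s in auto)
          also have "\<dots> \<le> E * ?X * real k powr (-2 - s)"
            using E(2) by (intro mult_right_mono) auto
          finally show ?thesis by (simp add: s_def)
        qed
        show "1 \<le> m \<or> integral {-pi..pi} f = 0 \<or> \<bar>a t 0 - 2 * a t 1 + a t 2\<bar> \<le> E * ?X"
        proof (cases "t \<le> T")
          case True
          have "\<bar>a t 0 - 2 * a t 1 + a t 2\<bar> \<le> 4 * \<phi> 0"
            using pos[of "t powr \<beta> * real 0 powr \<alpha>"] pos[of "t powr \<beta> * real 1 powr \<alpha>"]
              pos[of "t powr \<beta> * real 2 powr \<alpha>"] \<tau> unfolding a_def by auto
          also have "4 * \<phi> 0 = 4 * \<phi> 0 * (max 1 T powr (\<beta> * real l) * max 1 T powr (- (\<beta> * real l)))"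
            by (simp add: powr_minus)
          also have "\<dots> \<le> 4 * \<phi> 0 * (max 1 T powr (\<beta> * real l) * ?X)"
          proof -
            have "\<beta> / \<alpha> * s \<le> \<beta> * real l"
              using s(4) \<beta> mult_left_mono[OF s(4), of \<beta>] by simp
            then have "max 1 T powr (- (\<beta> * real l)) \<le> max 1 T powr (- (\<beta> / \<alpha>) * s)"
              by (intro powr_mono) auto
            also have "\<dots> \<le> ?X"
              using True t s(1) \<alpha> \<beta> by (intro powr_mono2') auto
            finally show ?thesis using pos[of 0] by (intro mult_left_mono) auto
          qed
          also have "\<dots> \<le> E * ?X"
            using C by (simp add: E_def distrib_right)
          finally show ?thesis by blast
        next
          case False
          then show ?thesis using tT by auto
        qed
      qed (use \<gamma>' f t E L1 coeffs lim in auto)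
      then show "holder_norm_le \<gamma>' (distr_deriv m (distr_of (conv_torus (P t) f)))
          (K * E * t powr (- (\<beta> / \<alpha>) * (\<gamma>' - \<gamma> + real m + \<kappa>)) * holder_norm \<gamma> f)"
        by (simp add: s_def mult.assoc)
    qed
  next
    define B where "B = 2 + \<beta> * (1 + 2 powr \<beta>)"
    have B: "B > 0" using \<beta> by (simp add: B_def add_pos_nonneg)
    show "\<exists>C>0. \<forall>\<gamma>'. \<gamma>' > 0 \<and> \<gamma>' \<notin> \<nat> \<and>
        0 \<le> \<gamma>' - \<gamma> + real m \<and> \<gamma>' - \<gamma> + real m < \<alpha> * real l \<and>
        \<kappa> \<le> \<gamma> - \<gamma>' + \<alpha> * real l - real m \<longrightarrow>
        (\<forall>\<epsilon>. 0 \<le> \<epsilon> \<and> \<epsilon> \<le> \<beta> \<and> \<epsilon> \<le> 1 \<longrightarrow>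
        (\<forall>f \<in> holder_space \<gamma>. \<forall>t>0. \<forall>t'>t.
           holder_norm_le \<gamma>' (distr_deriv m (distr_of (conv_torus (\<lambda>x. P t' x - P t x) f)))
             (C * (t' - t) powr \<epsilon> *
                t powr (- (\<beta> / \<alpha>) * (\<gamma>' - \<gamma> + real m + \<kappa>) - \<epsilon>) * holder_norm \<gamma> f)))"
    proof (intro exI[of _ "K * (3 * C * B)"] conjI allI impI ballI)
      show "K * (3 * C * B) > 0" using K C B by simp
      fix \<gamma>' \<epsilon> t t' :: real and f
      assume \<gamma>': "\<gamma>' > 0 \<and> \<gamma>' \<notin> \<nat> \<and> 0 \<le> \<gamma>' - \<gamma> + real m \<and> \<gamma>' - \<gamma> + real m < \<alpha> * real l \<and>
          \<kappa> \<le> \<gamma> - \<gamma>' + \<alpha> * real l - real m"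
        and \<epsilon>: "0 \<le> \<epsilon> \<and> \<epsilon> \<le> \<beta> \<and> \<epsilon> \<le> 1"
        and f: "f \<in> holder_space \<gamma>" and t: "0 < t" "t < t'"
      define s where "s = \<gamma>' - \<gamma> + real m + \<kappa>"
      have s: "0 < s" "s \<le> \<alpha> * real l" "0 \<le> s / \<alpha>" "s / \<alpha> \<le> real l"
        using \<gamma>' assms(9) \<alpha> by (auto simp: s_def divide_le_eq mult.commute)
      have \<tau>: "t powr \<beta> > 0" "t' powr \<beta> > 0" "t powr \<beta> < t' powr \<beta>"
        using t \<beta> by (auto intro: powr_less_mono2)
      let ?X = "t powr (- (\<beta> / \<alpha>) * s)"
      define R where "R = B * ((t' - t) / t) powr \<epsilon>"
      have R0: "0 \<le> R" using B by (simp add: R_def)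
      \<comment> \<open>The quotient of the two arguments of the symbol is (t' / t)^\<beta> at every
        frequency, so the gain in time factors out.\<close>
      have ratio: "min 2 (t' powr \<beta> * y / (t powr \<beta> * y) - 1) \<le> R" if "y > 0" for y
        using time_ratio_bound[OF t \<beta>, of \<epsilon>] \<epsilon> that t by (simp add: R_def B_def powr_divide)
      \<comment> \<open>Stated for a generic \<open>Q\<close>: \<Psi> is needed for the second
        differences at k >= 1, \<phi> for the one at k = 0.\<close>
      have sym: "\<bar>Q (t' powr \<beta> * x powr \<alpha>) - Q (t powr \<beta> * x powr \<alpha>)\<bar> \<le> C * ?X * R * x powr (- s)"
        if x: "x > 0" and Q: "\<And>y y' \<rho>. 0 < y \<Longrightarrow> y < y' \<Longrightarrow> 0 \<le> \<rho> \<Longrightarrow> \<rho> \<le> real l \<Longrightarrow>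
          \<bar>Q y' - Q y\<bar> \<le> C * y powr (- \<rho>) * min 2 (y' / y - 1)" for Q x
      proof -
        have "\<bar>Q (t' powr \<beta> * x powr \<alpha>) - Q (t powr \<beta> * x powr \<alpha>)\<bar> \<le>
            C * (t powr \<beta> * x powr \<alpha>) powr (- (s / \<alpha>)) *
              min 2 (t' powr \<beta> * x powr \<alpha> / (t powr \<beta> * x powr \<alpha>) - 1)"
          using x \<tau> s by (intro Q) auto
        also have "\<dots> \<le> C * (t powr \<beta> * x powr \<alpha>) powr (- (s / \<alpha>)) * R"
          using C x by (intro mult_left_mono ratio) auto
        finally show ?thesis using x t by (simp add: scale mult.assoc mult.left_commute mult.commute)
      qed
      have "holder_norm_le \<gamma>' (distr_deriv m (distr_of (conv_torus (\<lambda>x. P t' x - P t x) f)))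
          (K * (3 * (C * ?X * R)) * holder_norm \<gamma> f)"
      proof (rule estimate[where r = "\<lambda>k. a t' k - a t k"])
        show "(\<lambda>x. P t' x - P t x) \<in> L1_torus"
          using L1[of t] L1[of t'] t by (auto simp: L1_torus_def periodic_2pi_def)
        show "((\<lambda>u. (P t' u - P t u) * cos (real j * u)) has_integral sqrt (2 * pi) * (a t' j - a t j)) {-pi..pi}"
          "((\<lambda>u. (P t' u - P t u) * sin (real j * u)) has_integral 0) {-pi..pi}" for j
          using has_integral_diff[OF coeffs(1)[of t' j] coeffs(1)[of t j]]
            has_integral_diff[OF coeffs(2)[of t' j] coeffs(2)[of t j]] t
          by (simp_all add: left_diff_distrib right_diff_distrib)
        show "(\<lambda>k. real k * (a t' k - a t k)) \<longlonglongrightarrow> 0"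
          using tendsto_diff[OF lim[of t'] lim[of t]] t by (simp add: right_diff_distrib)
        show "\<bar>(a t' k - a t k) - 2 * (a t' (Suc k) - a t (Suc k)) + (a t' (Suc (Suc k)) - a t (Suc (Suc k)))\<bar>
            \<le> 3 * (C * ?X * R) * real k powr (-2 - (\<gamma>' - \<gamma> + real m + \<kappa>))" if "k \<ge> 1" for k
        proof -
          have "\<bar>(a t' k - a t k) - 2 * (a t' (Suc k) - a t (Suc k)) + (a t' (Suc (Suc k)) - a t (Suc (Suc k)))\<bar>
            \<le> C * ?X * R * real k powr (-2 - s)"
            unfolding a_def
          proof (rule second_difference_bound[OF DERIV_diff[OF d1[OF \<tau>(2)] d1[OF \<tau>(1)]]
                DERIV_diff[OF d2[OF \<tau>(2)] d2[OF \<tau>(1)]] _ _ _ that])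
            show "\<bar>x powr (-2) * \<Psi> (t' powr \<beta> * x powr \<alpha>) - x powr (-2) * \<Psi> (t powr \<beta> * x powr \<alpha>)\<bar>
                \<le> C * ?X * R * x powr (-2 - s)" if x: "x > 0" for x
            proof -
              from mult_left_mono[OF sym[OF x diff\<Psi>], of "x powr (-2)"]
              have "\<bar>x powr (-2) * (\<Psi> (t' powr \<beta> * x powr \<alpha>) - \<Psi> (t powr \<beta> * x powr \<alpha>))\<bar>
                  \<le> C * ?X * R * (x powr (-2) * x powr (- s))"
                by (simp add: abs_mult mult.left_commute mult.assoc)
              then show ?thesis by (simp add: right_diff_distrib flip: powr_add)
            qed
          qed (use C R0 s in auto)
          also have "\<dots> \<le> 3 * (C * ?X * R) * real k powr (-2 - s)"
            using C R0 by (intro mult_right_mono) auto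
          finally show ?thesis by (simp add: s_def)
        qed
        \<comment> \<open>In the second difference at 0 the entries \<open>a t' 0\<close> and
          \<open>a t 0\<close> cancel; the entries at 1 and 2 carry the weights 2 and 1, whence the
          factor 3.\<close>
        have "\<bar>a t' j - a t j\<bar> \<le> C * ?X * R" if "j \<ge> 1" for j
        proof -
          have "\<bar>a t' j - a t j\<bar> \<le> C * ?X * R * real j powr (- s)"
            unfolding a_def using that by (intro sym diff\<phi>) auto
          also have "\<dots> \<le> C * ?X * R * 1"
            using C R0 s that powr_mono[of "- s" 0 "real j"] by (intro mult_left_mono) auto
          finally show ?thesis by simp
        qed
        from this[of 1] this[of 2]
        show "1 \<le> m \<or> integral {-pi..pi} f = 0 \<or>
            \<bar>(a t' 0 - a t 0) - 2 * (a t' 1 - a t 1) + (a t' 2 - a t 2)\<bar> \<le> 3 * (C * ?X * R)"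
          using \<alpha> by (auto simp: a_def)
      qed (use \<gamma>' f C R0 in auto)
      moreover have "K * (3 * (C * ?X * R)) = K * (3 * C * B) * (t' - t) powr \<epsilon> * t powr (- (\<beta> / \<alpha>) * s - \<epsilon>)"
        using t by (simp add: R_def powr_divide powr_diff)
      ultimately show "holder_norm_le \<gamma>' (distr_deriv m (distr_of (conv_torus (\<lambda>x. P t' x - P t x) f)))
          (K * (3 * C * B) * (t' - t) powr \<epsilon> *
            t powr (- (\<beta> / \<alpha>) * (\<gamma>' - \<gamma> + real m + \<kappa>) - \<epsilon>) * holder_norm \<gamma> f)"
        by (simp only: s_def)
    qed
  qed
qed

end
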